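(* Consider the random difference equation $x_{n+1}=h(x_n,\omega_n)$ satisfying (H1) and (H2) (see context; $k\in\mathbb N_0$ is the exponent appearing in (H2)). Let the interval $M\subset X$ be the support of a stationary distribution of this equation, with density $\phi:M\to\mathbb{R}_+=[0,\infty)$. Suppose that the upper extremal map $h_+$ is a $C^{r+1}$-(local) diffeomorphism for some integer $r\ge2$, and that $x_+:=\sup M<\infty$ is a nonhyperbolic fixed point of $h_+$ such that $$h_+(x)=x+\alpha(x_+-x)^r+o((x_+-x)^r)\quad\text{as }x\to x_+$$ for some $\alpha>0$. Then $$\lim_{x\to x_+}\frac{(x_+-x)^{r-1}\ln\phi(x)}{\ln(x_+-x)}=\frac{r(k+1)}{\alpha(r-1)},$$ where the limit is taken over $x\in M$, $x<x_+$.
   Context: Setting. $X\subset\mathbb{R}$ is an interval, $\Delta=[-1,1]$, and $h:X\times\Delta\to X$ is continuously differentiable. $(\omega_n)_{n\ge0}$ is an i.i.d. sequence in $\Delta$ with common law $\nu$, a Borel probability measure with $\operatorname{supp}\nu=\Delta$. The Markov process is $x_{n+1}=h(x_n,\omega_n)$. (H1) Monotonicity: $\partial_xh(x,\omega)>0$ and $\partial_\omega h(x,\omega)>0$ for all $(x,\omega)\in X\times\Delta$. (H2) Shape of the noise density: $\nu$ is absolutely continuous with respect to Lebesgue measure, and its density $p:\Delta\to[0,\infty)$ is a $C^k$ function for some $k\in\mathbb{N}_0$ such that $p(\omega)>0$ for every $\omega\in(-1,1)$ and, for some $\beta>0$, $p(\omega)=\beta(1-\omega)^k+o((1-\omega)^k)$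 as $\omega\to1$. Extremal maps: $h_\pm(x):=h(x,\pm1)$; $h_+$ is the upper extremal map. Stationary distribution: a Borel probability measure $\mu$ on $X$ with $\mu(A)=\int_X\nu(\{\omega\in\Delta:h(x,\omega)\in A\})\,d\mu(x)$ for all Borel $A\subset X$. Any such $\mu$ is absolutely continuous with respect to Lebesgue measure. Its density $\phi$ is taken to be the representative satisfying the fixed point equation of the transfer operator pointwise: $$\phi(x)=\int_{\{y\in M:\ h_-(y)\le x\le h_+(y)\}}\frac{p(h_y^{-1}(x))}{\partial_\omega h(y,h_y^{-1}(x))}\,\phi(y)\,dy,$$ where $h_y^{-1}(x)$ denotes the unique $\omega\in\Delta$ with $h(y,\omega)=x$. *)

theory Defs
  imports "HOL-Probability.Probability" "HOL-Library.Landau_Symbols"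
begin

abbreviation Delta :: "real set" where
  "Delta \<equiv> {-1..1}"

text \<open>Derivatives are taken within the domain, hence are one-sided at boundary points.\<close>

definition C1_on :: "('a::real_normed_vector) set \<Rightarrow> ('a \<Rightarrow> real) \<Rightarrow> bool" where
  "C1_on S f \<longleftrightarrow>
     (\<exists>f' :: 'a \<Rightarrow> 'a \<Rightarrow>\<^sub>L real.
        (\<forall>z\<in>S. (f has_derivative blinfun_apply (f' z)) (at z within S)) \<and> continuous_on S f')"

primrec Ck_on :: "nat \<Rightarrow> real set \<Rightarrow> (real \<Rightarrow> real) \<Rightarrow> bool" where
  "Ck_on 0 S f \<longleftrightarrow> continuous_on S f"
| "Ck_on (Suc n) S f \<longleftrightarrow>
     (\<exists>f'. (\<forall>x\<in>S. (f has_real_derivative f' x) (at x within S)) \<and> Ck_on n S f')"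

definition diffeomorphism_onto_image :: "nat \<Rightarrow> real set \<Rightarrow> (real \<Rightarrow> real) \<Rightarrow> bool" where
  "diffeomorphism_onto_image n S f \<longleftrightarrow>
     inj_on f S \<and> Ck_on n S f \<and> Ck_on n (f ` S) (the_inv_into S f)"

definition local_diffeomorphism :: "nat \<Rightarrow> real set \<Rightarrow> (real \<Rightarrow> real) \<Rightarrow> bool" where
  "local_diffeomorphism n S f \<longleftrightarrow>
     (\<forall>x\<in>S. \<exists>U. open U \<and> x \<in> U \<and> diffeomorphism_onto_image n (S \<inter> U) f)"

definition nonhyperbolic_fixed_point :: "real set \<Rightarrow> (real \<Rightarrow> real) \<Rightarrow> real \<Rightarrow> bool" where
  "nonhyperbolic_fixed_point S f a \<longleftrightarrow>
     a \<in> S \<and> f a = a \<and> \<bar>vector_derivative f (at a within S)\<bar> = 1"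

text \<open>A Borel measure on an interval \<open>S\<close> is a measure with space \<open>S\<close>
  and the Borel sets of \<open>S\<close>; its support is a relatively closed subset of \<open>S\<close>.\<close>

definition measure_support :: "real measure \<Rightarrow> real set" where
  "measure_support m =
     {x \<in> space m. \<forall>U. open U \<and> x \<in> U \<longrightarrow> emeasure m (U \<inter> space m) > 0}"

definition borel_prob_on :: "real set \<Rightarrow> real measure \<Rightarrow> bool" where
  "borel_prob_on S m \<longleftrightarrow> prob_space m \<and> sets m = sets (restrict_space borel S)"

definition partial_x :: "real set \<Rightarrow> (real \<times> real \<Rightarrow> real) \<Rightarrow> real \<Rightarrow> real \<Rightarrow> real" where
  "partial_x X h x w = vector_derivative (\<lambda>x. h (x, w)) (at x within X)"

definition partial_w :: "(real \<times> real \<Rightarrow> real) \<Rightarrow> real \<Rightarrow> real \<Rightarrow> real" where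
  "partial_w h x w = vector_derivative (\<lambda>w. h (x, w)) (at w within Delta)"

text \<open>The data of \<open>x (n + 1) = h (x n, w n)\<close> with i.i.d. noise \<open>w n\<close> of common
  law \<open>\<nu>\<close>. Stationarity depends on the noise only through \<open>\<nu>\<close>, so no noise
  sequence is fixed.\<close>

definition random_difference_eq ::
    "real set \<Rightarrow> (real \<times> real \<Rightarrow> real) \<Rightarrow> real measure \<Rightarrow> bool" where
  "random_difference_eq X h \<nu> \<longleftrightarrow>
     is_interval X \<and>
     h ` (X \<times> Delta) \<subseteq> X \<and> C1_on (X \<times> Delta) h \<and>
     borel_prob_on Delta \<nu> \<and> measure_support \<nu> = Delta"

definition H1 :: "real set \<Rightarrow> (real \<times> real \<Rightarrow> real) \<Rightarrow> bool" where
  "H1 X h \<longleftrightarrow> (\<forall>x\<in>X. \<forall>w\<in>Delta. partial_x X h x w > 0 \<and> partial_w h x w > 0)"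

definition H2 :: "real measure \<Rightarrow> (real \<Rightarrow> real) \<Rightarrow> nat \<Rightarrow> bool" where
  "H2 \<nu> p k \<longleftrightarrow>
     (\<forall>w\<in>Delta. p w \<ge> 0) \<and> Ck_on k Delta p \<and>
     \<nu> = density (restrict_space lborel Delta) (\<lambda>w. ennreal (p w)) \<and>
     (\<forall>w\<in>{-1<..<1}. p w > 0) \<and>
     (\<exists>\<beta>>0. (\<lambda>w. p w - \<beta> * (1 - w) ^ k) \<in> o[at_left 1](\<lambda>w. (1 - w) ^ k))"

definition stationary_distribution ::
    "real set \<Rightarrow> (real \<times> real \<Rightarrow> real) \<Rightarrow> real measure \<Rightarrow> real measure \<Rightarrow> bool" where
  "stationary_distribution X h \<nu> \<mu> \<longleftrightarrow>
     borel_prob_on X \<mu> \<and>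
     (\<forall>A\<in>sets \<mu>. emeasure \<mu> A = (\<integral>\<^sup>+x. emeasure \<nu> {w \<in> Delta. h (x, w) \<in> A} \<partial>\<mu>))"

definition fibre_inv :: "(real \<times> real \<Rightarrow> real) \<Rightarrow> real \<Rightarrow> real \<Rightarrow> real" where
  "fibre_inv h y = the_inv_into Delta (\<lambda>w. h (y, w))"

text \<open>Only the values of \<open>\<phi>\<close> on the support \<open>M\<close> matter. The fixed point
  equation is stated with the nonnegative integral, so that it includes finiteness of the
  right-hand side.\<close>

definition stationary_density ::
    "real set \<Rightarrow> (real \<times> real \<Rightarrow> real) \<Rightarrow> (real \<Rightarrow> real) \<Rightarrow> real measure \<Rightarrow> (real \<Rightarrow> real) \<Rightarrow> bool" where
  "stationary_density X h p \<mu> \<phi> \<longleftrightarrow>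
     (let M = measure_support \<mu> in
       (\<forall>x\<in>M. \<phi> x \<ge> 0) \<and>
       \<phi> \<in> borel_measurable (restrict_space borel M) \<and>
       \<mu> = density (restrict_space lborel X) (\<lambda>x. ennreal (\<phi> x) * indicator M x) \<and>
       (\<forall>x\<in>M. ennreal (\<phi> x) =
          (\<integral>\<^sup>+y\<in>{y \<in> M. h (y, -1) \<le> x \<and> x \<le> h (y, 1)}.
             ennreal (p (fibre_inv h y x) / partial_w h y (fibre_inv h y x) * \<phi> y) \<partial>lborel)))"

end

theory Submission imports Defs "HOL-Real_Asymp.Real_Asymp" begin

text \<open>
  In the coordinate \<open>u = xp - x\<close> put \<open>\<psi> u = \<phi> x\<close>, and let \<open>H v = v - \<alpha> v^r + \<dots>\<close> be the upper
  extremal map. Near \<open>0\<close> the fixed point equation says that \<open>\<psi> u\<close> is comparable to the integral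
  of \<open>(u - H v)^k \<psi> v\<close> over \<open>{v. H v \<le> u}\<close>: one factor \<open>(1 - \<omega>)^k\<close> of the noise density
  turns into \<open>(u - H v)^k\<close> by the mean value theorem in \<open>\<omega>\<close>.

  Compare \<open>\<psi>\<close> with \<open>exp (\<kappa> ln u / u^(r-1))\<close>. Over one step of size about \<open>\<alpha> u^r\<close> this function
  gains a factor of about \<open>u^(-\<kappa> \<alpha> (r-1))\<close>, whereas the integral operator costs a factor of order
  \<open>u^(r(k+1))\<close>. So it is a supersolution for \<open>\<kappa> < r(k+1)/(\<alpha>(r-1))\<close> and a subsolution for \<open>\<kappa>\<close>
  beyond this value. The upper comparison works because the operator contracts near \<open>0\<close>, the lower
  one by propagating a positive lower bound towards \<open>0\<close> in steps of positive length.
\<close>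

section \<open>Integral equations with a kernel tangent to the diagonal\<close>

lemma power_at_right_0: "1 \<le> n \<Longrightarrow> ((\<lambda>u::real. u ^ n) \<longlongrightarrow> 0) (at_right 0)"
proof -
  assume "1 \<le> n"
  have "((\<lambda>u::real. u ^ n) \<longlongrightarrow> 0 ^ n) (at_right 0)"
    by (intro tendsto_intros)
  with \<open>1 \<le> n\<close> show ?thesis by (simp add: power_0_left)
qed

lemma exp_ln_at_right_0:
  fixes c :: real
  assumes "0 < c"
  shows "((\<lambda>u. exp (c * ln u)) \<longlongrightarrow> 0) (at_right 0)"
  using assms by real_asymp

lemma ln_over_power_mono:
  fixes u v :: real and q :: nat
  assumes "0 < u" "u \<le> v" "v < 1"
  shows "ln u / u ^ q \<le> ln v / v ^ q"
proof -
  have "ln u / u ^ q \<le> ln u / v ^ q"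
    using assms by (intro divide_left_mono_neg power_mono) auto
  also have "\<dots> \<le> ln v / v ^ q"
    using assms by (intro divide_right_mono) auto
  finally show ?thesis .
qed

text \<open>Replacing \<open>ln w\<close> by \<open>ln u\<close> only loses. What remains is
  \<open>- ln u / u ^ q\<close> times \<open>1 - 1 / (1 + t) ^ q\<close>, where
  \<open>t = A * u ^ q\<close> and \<open>w = u * (1 + t)\<close>, and Bernoulli's inequality bounds
  the second factor below by \<open>q * t / (1 + q * t)\<close>. The denominator tends to 1 as
  \<open>u\<close> tends to 0.\<close>

lemma ln_over_power_step_lower:
  fixes u A :: real and q :: nat
  assumes u: "0 < u" "u < 1" and A: "0 \<le> A"
  defines "w \<equiv> u + A * u ^ Suc q"
  shows "- ln u * (q * (A / (1 + q * A * u ^ q))) \<le> ln w / w ^ q - ln u / u ^ q"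
proof -
  define t where "t = A * u ^ q"
  have t: "0 \<le> t" using u A by (simp add: t_def)
  have w: "w = u * (1 + t)" by (simp add: w_def t_def algebra_simps)
  have wq: "w ^ q = u ^ q * (1 + t) ^ q" by (simp only: w power_mult_distrib)
  have "1 + q * t \<le> (1 + t) ^ q" using t by (intro Bernoulli_inequality) auto
  then have "1 / (1 + t) ^ q \<le> 1 / (1 + q * t)"
    using t by (intro divide_left_mono) (auto intro!: add_pos_nonneg mult_pos_pos)
  also have "\<dots> = 1 - q * t / (1 + q * t)"
    using t add_pos_nonneg[of 1 "q * t"] by (simp add: field_simps)
  finally have *: "q * t / (1 + q * t) \<le> 1 - 1 / (1 + t) ^ q" by simp
  have "- ln u * (q * (A / (1 + q * A * u ^ q))) = - ln u / u ^ q * (q * t / (1 + q * t))"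
    using u by (simp add: t_def mult.assoc)
  also have "\<dots> \<le> - ln u / u ^ q * (1 - 1 / (1 + t) ^ q)"
    using u by (intro mult_left_mono *) (auto intro!: divide_nonpos_pos)
  also have "\<dots> = ln u / w ^ q - ln u / u ^ q"
    by (simp add: wq right_diff_distrib)
  also have "\<dots> \<le> ln w / w ^ q - ln u / u ^ q"
  proof -
    have "u \<le> w" using u A by (simp add: w_def)
    then show ?thesis using u by (intro diff_right_mono divide_right_mono) auto
  qed
  finally show ?thesis .
qed

text \<open>The excess \<open>ln (1 + t) \<le> t\<close> of \<open>ln w\<close> over
  \<open>ln u\<close> produces the additive error \<open>t / u ^ q = A\<close>. Bernoulli's
  inequality is applied to the base \<open>1 / (1 + t) = 1 - t / (1 + t)\<close>.\<close>

lemma ln_over_power_step_upper: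
  fixes u A :: real and q :: nat
  assumes u: "0 < u" "u < 1" and A: "0 \<le> A"
  defines "w \<equiv> u + A * u ^ Suc q"
  shows "ln w / w ^ q - ln u / u ^ q \<le> - ln u * (q * A) + A"
proof -
  define t where "t = A * u ^ q"
  have t: "0 \<le> t" using u A by (simp add: t_def)
  have w: "w = u * (1 + t)" by (simp add: w_def t_def algebra_simps)
  have wq: "w ^ q = u ^ q * (1 + t) ^ q" by (simp only: w power_mult_distrib)
  have "u \<le> w" using u A by (simp add: w_def)
  have "1 + q * (- (t / (1 + t))) \<le> (1 + (- (t / (1 + t)))) ^ q"
    using t by (intro Bernoulli_inequality) (auto simp: field_simps)
  also have "1 + (- (t / (1 + t))) = 1 / (1 + t)"
    using t by (simp add: field_simps)
  finally have "1 - 1 / (1 + t) ^ q \<le> q * (t / (1 + t))"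
    by (simp add: power_one_over)
  also have "\<dots> \<le> q * t"
    using t by (intro mult_left_mono) (auto simp: field_simps)
  finally have *: "1 - 1 / (1 + t) ^ q \<le> q * t" .
  have "ln w = ln u + ln (1 + t)" using u t by (simp add: w ln_mult)
  also have "\<dots> \<le> ln u + t" using t ln_add_one_self_le_self[of t] by simp
  finally have "ln w / w ^ q \<le> (ln u + t) / w ^ q"
    using u \<open>u \<le> w\<close> by (intro divide_right_mono) auto
  also have "\<dots> = ln u / w ^ q + t / w ^ q" by (rule add_divide_distrib)
  also have "t / w ^ q \<le> t / u ^ q"
    using u t \<open>u \<le> w\<close> by (intro divide_left_mono power_mono) auto
  also have "t / u ^ q = A" using u by (simp add: t_def)
  finally have "ln w / w ^ q - ln u / u ^ q \<le> ln u / w ^ q - ln u / u ^ q + A" by simp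
  also have "ln u / w ^ q - ln u / u ^ q = - ln u / u ^ q * (1 - 1 / (1 + t) ^ q)"
    by (simp add: wq right_diff_distrib)
  also have "\<dots> \<le> - ln u / u ^ q * (q * t)"
    using u by (intro mult_left_mono *) (auto intro!: divide_nonpos_pos)
  also have "\<dots> = - ln u * (q * A)" using u by (simp add: t_def)
  finally show ?thesis by simp
qed

section \<open>Integral inequalities near a parabolic fixed point\<close>

text \<open>The fixed point equation in the coordinate \<open>u = xp - x\<close>, with
  \<open>q = r - 1\<close>. The window \<open>(0, d]\<close> contains every point that can feed a
  \<open>u < b\<close>. Two inequalities with separate constants stand in for the equation, because
  the true kernel is only comparable to \<open>(u - H v) ^ k\<close>. Positive mass of every
  \<open>(0, t]\<close> expresses that 0 is an endpoint of the support.\<close>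

locale parabolic_kernel =
  fixes \<psi> H :: "real \<Rightarrow> real" and b d C1 C2 \<alpha> :: real and k q :: nat
  assumes q_pos: "1 \<le> q" and alpha_pos: "0 < \<alpha>"
    and b_pos: "0 < b" and b_le_d: "b \<le> d"
    and C1_pos: "0 < C1" and C2_pos: "0 < C2"
    and H_0: "H 0 = 0"
    and H_mono: "\<And>v w. 0 \<le> v \<Longrightarrow> v \<le> w \<Longrightarrow> w \<le> d \<Longrightarrow> H v \<le> H w"
    and H_lim: "((\<lambda>v. (v - H v) / v ^ Suc q) \<longlongrightarrow> \<alpha>) (at_right 0)"
    and psi_measurable: "\<psi> \<in> borel_measurable borel"
    and psi_nonneg: "\<And>v. 0 \<le> \<psi> v"
    and psi_le: "\<And>u. 0 < u \<Longrightarrow> u < b \<Longrightarrow>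
      ennreal (\<psi> u) \<le> (\<integral>\<^sup>+v\<in>{v\<in>{0<..d}. H v \<le> u}. ennreal (C2 * (u - H v) ^ k * \<psi> v) \<partial>lborel)"
    and psi_ge: "\<And>u. 0 < u \<Longrightarrow> u < b \<Longrightarrow>
      (\<integral>\<^sup>+v\<in>{v\<in>{0<..d}. H v \<le> u}. ennreal (C1 * (u - H v) ^ k * \<psi> v) \<partial>lborel) \<le> ennreal (\<psi> u)"
    and mass_pos: "\<And>t. 0 < t \<Longrightarrow> t \<le> d \<Longrightarrow> 0 < (\<integral>\<^sup>+v\<in>{0<..t}. ennreal (\<psi> v) \<partial>lborel)"
    and mass_finite: "(\<integral>\<^sup>+v\<in>{0<..d}. ennreal (\<psi> v) \<partial>lborel) < \<infinity>"
begin

section \<open>Localisation of the preimages under the extremal map\<close>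

lemma H_nonneg: "0 \<le> v \<Longrightarrow> v \<le> d \<Longrightarrow> 0 \<le> H v"
  using H_mono[of 0 v] H_0 by simp

lemma H_lower_bound: 
  assumes "\<alpha> < A"
  obtains e where "0 < e" "\<And>v. 0 < v \<Longrightarrow> v < e \<Longrightarrow> v - H v \<le> A * v ^ Suc q"
proof -
  have "\<forall>\<^sub>F v in at_right 0. (v - H v) / v ^ Suc q < A"
    using H_lim assms by (rule order_tendstoD)
  then obtain e where e: "0 < e" "\<And>v. 0 < v \<Longrightarrow> v < e \<Longrightarrow> (v - H v) / v ^ Suc q < A"
    unfolding eventually_at_right_field by blast
  show thesis
  proof (rule that[of e])
    fix v :: real assume v: "0 < v" "v < e"
    have "0 < v ^ Suc q" using v by simp
    then show "v - H v \<le> A * v ^ Suc q" 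
      using e(2)[OF v] by (simp add: pos_divide_less_eq del: power_Suc)
  qed (rule e(1))
qed

lemma H_upper_bound: 
  assumes "A < \<alpha>"
  obtains e where "0 < e" "\<And>v. 0 < v \<Longrightarrow> v < e \<Longrightarrow> A * v ^ Suc q \<le> v - H v"
proof -
  have "\<forall>\<^sub>F v in at_right 0. A < (v - H v) / v ^ Suc q"
    using H_lim assms by (rule order_tendstoD)
  then obtain e where e: "0 < e" "\<And>v. 0 < v \<Longrightarrow> v < e \<Longrightarrow> A < (v - H v) / v ^ Suc q"
    unfolding eventually_at_right_field by blast
  show thesis
  proof (rule that[of e])
    fix v :: real assume v: "0 < v" "v < e"
    have "0 < v ^ Suc q" using v by simp
    then show "A * v ^ Suc q \<le> v - H v" 
      using e(2)[OF v] by (simp add: pos_less_divide_eq del: power_Suc)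
  qed (rule e(1))
qed

text \<open>For \<open>A1\<close> strictly between \<alpha> and \<open>A\<close>,
  \<open>v - u \<le> v - H v \<le> A1 * v ^ Suc q\<close>. This also gives
  \<open>v * (1 - A1 * v ^ q) \<le> u\<close>, so \<open>v ^ Suc q\<close> exceeds
  \<open>u ^ Suc q\<close> at most by a factor close to 1, which the gap between \<open>A1\<close>
  and \<open>A\<close> absorbs.\<close>

lemma preimage_localized:
  assumes "\<alpha> < A"
  shows "\<forall>\<^sub>F u in at_right 0. \<forall>v\<in>{0<..d}. H v \<le> u \<longrightarrow> v \<le> u + A * u ^ Suc q"
proof -
  obtain A1 where A1: "\<alpha> < A1" "A1 < A" using assms dense by blast
  have A1_pos: "0 < A1" using A1 alpha_pos by simp
  obtain e1 where e1: "0 < e1" "\<And>v. 0 < v \<Longrightarrow> v < e1 \<Longrightarrow> v - H v \<le> A1 * v ^ Suc q"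
    using H_lower_bound[OF A1(1)] by blast
  have "((\<lambda>v. A * (1 - A1 * v ^ q) ^ Suc q) \<longlongrightarrow> A * (1 - A1 * 0) ^ Suc q) (at_right 0)"
    by (intro tendsto_intros power_at_right_0 q_pos)
  then have "\<forall>\<^sub>F v in at_right 0. A1 < A * (1 - A1 * v ^ q) ^ Suc q"
    by (rule order_tendstoD) (use A1 in simp)
  moreover have "((\<lambda>v. A1 * v ^ q) \<longlongrightarrow> A1 * 0) (at_right 0)"
    by (intro tendsto_intros power_at_right_0 q_pos)
  then have "\<forall>\<^sub>F v in at_right 0. A1 * v ^ q < 1"
    by (rule order_tendstoD) simp
  ultimately have "\<forall>\<^sub>F v in at_right 0. A1 < A * (1 - A1 * v ^ q) ^ Suc q \<and> A1 * v ^ q < 1"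
    by eventually_elim simp
  then obtain e2 where e2: "0 < e2" "\<And>v. 0 < v \<Longrightarrow> v < e2 \<Longrightarrow> A1 < A * (1 - A1 * v ^ q) ^ Suc q"
    "\<And>v. 0 < v \<Longrightarrow> v < e2 \<Longrightarrow> A1 * v ^ q < 1"
    unfolding eventually_at_right_field by blast
  \<comment> \<open>\<open>H s\<close> serves as the radius for \<open>u\<close>: if
    \<open>H v \<le> u < H s\<close>, monotonicity forces \<open>v \<le> s\<close>, so
    \<open>v\<close> lies in the range where the expansion at 0 applies.\<close>
  define s where "s = Min {e1, e2, d} / 2"
  have s: "0 < s" "s < e1" "s < e2" "s < d"
    using e1(1) e2(1) b_pos b_le_d by (auto simp: s_def min_def)
  have "A1 * s ^ Suc q = s * (A1 * s ^ q)" by simp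
  also have "\<dots> < s * 1"
    using s e2(3)[of s] by (intro mult_strict_left_mono) auto
  finally have Hs: "0 < H s" using e1(2)[of s] s by linarith
  have "v \<le> u + A * u ^ Suc q" if u: "0 < u" "u < H s" and v: "0 < v" "v \<le> d" "H v \<le> u" for u v
  proof -
    have "v \<le> s" using H_mono[of s v] s u v by (cases "v \<le> s") auto
    then have v': "v < e1" "v < e2" using s by auto
    have *: "v - u \<le> A1 * v ^ Suc q" using e1(2)[of v] v v' by simp
    then have "v * (1 - A1 * v ^ q) \<le> u" by (simp add: algebra_simps)
    then have "(v * (1 - A1 * v ^ q)) ^ Suc q \<le> u ^ Suc q"
      using v e2(3)[OF v(1) v'(2)] by (intro power_mono) auto
    then have "A * (v * (1 - A1 * v ^ q)) ^ Suc q \<le> A * u ^ Suc q"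
      using A1 A1_pos by (intro mult_left_mono) auto
    moreover have "A1 * v ^ Suc q \<le> (A * (1 - A1 * v ^ q) ^ Suc q) * v ^ Suc q"
      using e2(2)[OF v(1) v'(2)] v by (intro mult_right_mono) auto
    ultimately have "A1 * v ^ Suc q \<le> A * u ^ Suc q"
      by (simp only: power_mult_distrib ac_simps)
    with * show ?thesis by simp
  qed
  then show ?thesis
    unfolding eventually_at_right_field using Hs by (intro exI[of _ "H s"]) auto
qed

section \<open>Estimates from one application of the integral inequalities\<close>

text \<open>The integral is split at \<open>u\<close>. Below \<open>u\<close> the weight is at most
  \<open>u ^ k\<close>, since \<open>H\<close> is nonnegative; above \<open>u\<close> monotonicity
  gives \<open>u - H v \<le> u - H u \<le> D\<close>. The second piece is where the comparison
  function grows, so the small factors \<open>D\<close> and \<open>w - u\<close> must be kept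
  there.\<close>

lemma step_upper:
  assumes u: "0 < u" "u < b" and w: "u \<le> w" "w \<le> d"
    and loc: "\<And>v. 0 < v \<Longrightarrow> v \<le> d \<Longrightarrow> H v \<le> u \<Longrightarrow> v \<le> w"
    and g: "0 \<le> g1" "0 \<le> g2" "\<And>v. 0 < v \<Longrightarrow> v \<le> u \<Longrightarrow> \<psi> v \<le> g1"
      "\<And>v. u < v \<Longrightarrow> v \<le> w \<Longrightarrow> \<psi> v \<le> g2"
    and D: "0 \<le> D" "u - H u \<le> D"
  shows "\<psi> u \<le> C2 * u ^ k * (u * g1) + C2 * D ^ k * ((w - u) * g2)"
proof -
  have "ennreal (\<psi> u) \<le> (\<integral>\<^sup>+v\<in>{v\<in>{0<..d}. H v \<le> u}. ennreal (C2 * (u - H v) ^ k * \<psi> v) \<partial>lborel)"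
    by (rule psi_le[OF u])
  also have "\<dots> \<le> (\<integral>\<^sup>+v. ennreal (C2 * u ^ k * g1) * indicator {0<..u} v + 
      ennreal (C2 * D ^ k * g2) * indicator {u<..w} v \<partial>lborel)"
  proof (intro nn_integral_mono)
    fix v
    consider "0 < v" "v \<le> d" "H v \<le> u" "v \<le> u" | "0 < v" "v \<le> d" "H v \<le> u" "u < v" 
      | "\<not> (0 < v \<and> v \<le> d \<and> H v \<le> u)"
      by linarith
    then show "ennreal (C2 * (u - H v) ^ k * \<psi> v) * indicator {v\<in>{0<..d}. H v \<le> u} v
      \<le> ennreal (C2 * u ^ k * g1) * indicator {0<..u} v + ennreal (C2 * D ^ k * g2) * indicator {u<..w} v"
    proof cases
      case 1
      have "C2 * (u - H v) ^ k * \<psi> v \<le> C2 * u ^ k * g1"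
        using 1 H_nonneg[of v] C2_pos g psi_nonneg u by (intro mult_mono power_mono) auto
      then show ?thesis using 1 by (auto simp: indicator_def ennreal_leI)
    next
      case 2
      have "H u \<le> H v" using 2 u by (intro H_mono) auto
      then have "C2 * (u - H v) ^ k * \<psi> v \<le> C2 * D ^ k * g2"
        using 2 C2_pos g psi_nonneg u loc[OF 2(1-3)] D by (intro mult_mono power_mono) auto
      then show ?thesis using 2 loc[OF 2(1-3)] by (auto simp: indicator_def ennreal_leI)
    qed (auto simp: indicator_def)
  qed
  also have "\<dots> = ennreal (C2 * u ^ k * g1) * ennreal u + ennreal (C2 * D ^ k * g2) * ennreal (w - u)"
    using u w by (simp add: nn_integral_add nn_integral_cmult_indicator)
  also have "\<dots> = ennreal (C2 * u ^ k * (u * g1) + C2 * D ^ k * ((w - u) * g2))"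
    using u w g C2_pos D(1)
    by (simp add: ennreal_mult'[symmetric] ennreal_plus[symmetric] ac_simps del: ennreal_plus)
  finally show ?thesis
    using u w g C2_pos D(1) by (subst (asm) ennreal_le_iff) auto
qed

text \<open>The kernel is bounded by \<open>C2 * b ^ k\<close> and \<psi> has finite mass on the
  window.\<close>

lemma psi_bounded:
  obtains B where "0 \<le> B" "\<And>u. 0 < u \<Longrightarrow> u < b \<Longrightarrow> \<psi> u \<le> B"
proof -
  define J where "J = enn2real (\<integral>\<^sup>+v\<in>{0<..d}. ennreal (\<psi> v) \<partial>lborel)"
  have J: "ennreal J = (\<integral>\<^sup>+v\<in>{0<..d}. ennreal (\<psi> v) \<partial>lborel)"
    unfolding J_def using mass_finite by (intro ennreal_enn2real) auto
  have J0: "0 \<le> J" unfolding J_def by simp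
  note [measurable] = psi_measurable
  have "\<psi> u \<le> C2 * b ^ k * J" if u: "0 < u" "u < b" for u
  proof -
    have "ennreal (\<psi> u) \<le> (\<integral>\<^sup>+v\<in>{v\<in>{0<..d}. H v \<le> u}. ennreal (C2 * (u - H v) ^ k * \<psi> v) \<partial>lborel)"
      by (rule psi_le[OF u])
    also have "\<dots> \<le> (\<integral>\<^sup>+v. ennreal (C2 * b ^ k) * (ennreal (\<psi> v) * indicator {0<..d} v) \<partial>lborel)"
    proof (intro nn_integral_mono)
      fix v
      have "C2 * (u - H v) ^ k * \<psi> v \<le> C2 * b ^ k * \<psi> v" if "0 < v" "v \<le> d" "H v \<le> u"
        using that H_nonneg[of v] C2_pos psi_nonneg u by (intro mult_mono power_mono) auto
      then show "ennreal (C2 * (u - H v) ^ k * \<psi> v) * indicator {v\<in>{0<..d}. H v \<le> u} v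
        \<le> ennreal (C2 * b ^ k) * (ennreal (\<psi> v) * indicator {0<..d} v)"
        using C2_pos b_pos
        by (auto simp: indicator_def ennreal_mult'[symmetric] ennreal_leI)
    qed
    also have "\<dots> = ennreal (C2 * b ^ k) * ennreal J"
      unfolding J by (intro nn_integral_cmult) measurable
    also have "\<dots> = ennreal (C2 * b ^ k * J)"
      using J0 C2_pos b_pos by (simp add: ennreal_mult'[symmetric])
    finally show ?thesis using J0 C2_pos b_pos by (subst (asm) ennreal_le_iff) auto
  qed
  then show thesis using that[of "C2 * b ^ k * J"] J0 C2_pos b_pos by auto
qed

text \<open>Only the part of the integral over \<open>[s, t]\<close> is kept; there
  \<open>u - H v \<ge> u - H t \<ge> D\<close>.\<close>

lemma step_lower:
  assumes u: "0 < u" "u < b" and st: "0 < s" "s \<le> t" "t \<le> d" "H t \<le> u - D"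
    and g: "0 \<le> g" "\<And>v. s \<le> v \<Longrightarrow> v \<le> t \<Longrightarrow> g \<le> \<psi> v" and D: "0 \<le> D"
  shows "C1 * D ^ k * ((t - s) * g) \<le> \<psi> u"
proof -
  have "ennreal (C1 * D ^ k * ((t - s) * g)) = ennreal (C1 * D ^ k * g) * ennreal (t - s)"
    using C1_pos D g st by (simp add: ennreal_mult'[symmetric] ac_simps)
  also have "\<dots> = (\<integral>\<^sup>+v. ennreal (C1 * D ^ k * g) * indicator {s..t} v \<partial>lborel)"
    using st by (simp add: nn_integral_cmult_indicator)
  also have "\<dots> \<le> (\<integral>\<^sup>+v\<in>{v\<in>{0<..d}. H v \<le> u}. ennreal (C1 * (u - H v) ^ k * \<psi> v) \<partial>lborel)"
  proof (intro nn_integral_mono)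
    fix v
    have "C1 * D ^ k * g \<le> C1 * (u - H v) ^ k * \<psi> v" "H v \<le> u" if "s \<le> v" "v \<le> t"
    proof -
      have "H v \<le> H t" using that st by (intro H_mono) auto
      then show "H v \<le> u" using st D by simp
      show "C1 * D ^ k * g \<le> C1 * (u - H v) ^ k * \<psi> v"
        using \<open>H v \<le> H t\<close> st D g that C1_pos by (intro mult_mono power_mono) auto
    qed
    then show "ennreal (C1 * D ^ k * g) * indicator {s..t} v
       \<le> ennreal (C1 * (u - H v) ^ k * \<psi> v) * indicator {v\<in>{0<..d}. H v \<le> u} v"
      using st by (auto simp: indicator_def ennreal_leI)
  qed
  also have "\<dots> \<le> ennreal (\<psi> u)" by (rule psi_ge[OF u])
  finally show ?thesis using psi_nonneg by (subst (asm) ennreal_le_iff) auto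
qed

text \<open>This starts the lower comparison: no pointwise lower bound for \<psi> is known yet, but
  the mass of \<open>(0, t]\<close> is positive and every point of it feeds \<open>u\<close> with
  weight at least \<open>C1 * D ^ k\<close>.\<close>

lemma psi_lower_const:
  assumes t: "0 < t" "t \<le> d" and D: "0 < D"
  obtains a where "0 < a" "\<And>u. 0 < u \<Longrightarrow> u < b \<Longrightarrow> H t + D \<le> u \<Longrightarrow> a \<le> \<psi> u"
proof -
  note [measurable] = psi_measurable
  define J where "J = enn2real (\<integral>\<^sup>+v\<in>{0<..t}. ennreal (\<psi> v) \<partial>lborel)"
  have "(\<integral>\<^sup>+v\<in>{0<..t}. ennreal (\<psi> v) \<partial>lborel) \<le> (\<integral>\<^sup>+v\<in>{0<..d}. ennreal (\<psi> v) \<partial>lborel)"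
    using t by (intro nn_integral_mono) (auto simp: indicator_def)
  then have fin: "(\<integral>\<^sup>+v\<in>{0<..t}. ennreal (\<psi> v) \<partial>lborel) < \<infinity>" using mass_finite by (rule le_less_trans)
  then have J: "ennreal J = (\<integral>\<^sup>+v\<in>{0<..t}. ennreal (\<psi> v) \<partial>lborel)"
    unfolding J_def by (intro ennreal_enn2real) auto
  have J0: "0 < J" unfolding J_def using mass_pos[OF t] fin by (intro enn2real_positive_iff[THEN iffD2]) auto
  have "C1 * D ^ k * J \<le> \<psi> u" if u: "0 < u" "u < b" "H t + D \<le> u" for u
  proof -
    have "ennreal (C1 * D ^ k * J) = ennreal (C1 * D ^ k) * ennreal J"
      using J0 C1_pos D by (simp add: ennreal_mult'[symmetric])
    also have "\<dots> = (\<integral>\<^sup>+v. ennreal (C1 * D ^ k) * (ennreal (\<psi> v) * indicator {0<..t} v) \<partial>lborel)"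
      unfolding J by (intro nn_integral_cmult[symmetric]) measurable
    also have "\<dots> \<le> (\<integral>\<^sup>+v\<in>{v\<in>{0<..d}. H v \<le> u}. ennreal (C1 * (u - H v) ^ k * \<psi> v) \<partial>lborel)"
    proof (intro nn_integral_mono)
      fix v
      have "C1 * D ^ k * \<psi> v \<le> C1 * (u - H v) ^ k * \<psi> v" "H v \<le> u" if "0 < v" "v \<le> t"
      proof -
        have "H v \<le> H t" using that t by (intro H_mono) auto
        then show "H v \<le> u" using u D by simp
        show "C1 * D ^ k * \<psi> v \<le> C1 * (u - H v) ^ k * \<psi> v"
          using \<open>H v \<le> H t\<close> u D C1_pos psi_nonneg by (intro mult_mono power_mono) auto
      qed
      then show "ennreal (C1 * D ^ k) * (ennreal (\<psi> v) * indicator {0<..t} v)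
        \<le> ennreal (C1 * (u - H v) ^ k * \<psi> v) * indicator {v\<in>{0<..d}. H v \<le> u} v"
        using C1_pos D t
        by (auto simp: indicator_def ennreal_mult'[symmetric] ennreal_leI)
    qed
    also have "\<dots> \<le> ennreal (\<psi> u)" by (rule psi_ge[OF u(1,2)])
    finally show ?thesis using psi_nonneg by (subst (asm) ennreal_le_iff) auto
  qed
  then show thesis using that[of "C1 * D ^ k * J"] J0 C1_pos D by auto
qed


section \<open>The comparison functions \<open>u\<close> to the power
  \<open>\<kappa> / u ^ q\<close>\<close>

definition comparison :: "real \<Rightarrow> real \<Rightarrow> real" where
  "comparison \<kappa> u = exp (\<kappa> * (ln u / u ^ q))"

lemma comparison_pos: "0 < comparison \<kappa> u"
  by (simp add: comparison_def)

lemma comparison_mono: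
  "0 \<le> \<kappa> \<Longrightarrow> 0 < u \<Longrightarrow> u \<le> v \<Longrightarrow> v < 1 \<Longrightarrow> comparison \<kappa> u \<le> comparison \<kappa> v"
  unfolding comparison_def exp_le_cancel_iff
  by (intro mult_left_mono ln_over_power_mono) auto

lemma comparison_le_1: "0 \<le> \<kappa> \<Longrightarrow> 0 < u \<Longrightarrow> u < 1 \<Longrightarrow> comparison \<kappa> u \<le> 1"
  by (simp add: comparison_def mult_nonneg_nonpos divide_nonpos_nonneg)

text \<open>For such \<kappa> the cost \<open>u ^ (Suc q * (k + 1))\<close> of one application of
  the operator outweighs the growth of \<open>comparison \<kappa>\<close> over the localised window,
  so a multiple of it is a supersolution near 0. The bound is then obtained from boundedness of
  \<psi> by iteration.\<close>

lemma psi_le_comparison: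
  assumes l: "0 < \<kappa>" and L: "\<kappa> * (\<alpha> * q) < Suc q * (k + 1)"
  obtains A where "0 < A" "\<forall>\<^sub>F u in at_right 0. \<psi> u \<le> A * comparison \<kappa> u"
proof -
  have lq: "0 < \<kappa> * q" using l q_pos by simp
  have "\<alpha> < Suc q * (k + 1) / (\<kappa> * q)"
    using L lq by (simp add: pos_less_divide_eq ac_simps)
  \<comment> \<open>\<open>A'\<close> exceeds \<alpha> so that preimages are localised, yet is small
    enough to leave the exponent \<open>c\<close> below positive.\<close>
  then obtain A' where A': "\<alpha> < A'" "A' < Suc q * (k + 1) / (\<kappa> * q)"
    using dense by blast
  have A'_pos: "0 < A'" using A' alpha_pos by simp
  define n where "n = Suc q * (k + 1)"
  define c where "c = n - \<kappa> * q * A'"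
  have c: "0 < c"
    using A' lq by (simp add: c_def n_def pos_less_divide_eq ac_simps)
  \<comment> \<open>\<open>E u\<close> bounds the ratio of the comparison function at
    \<open>u + A' * u ^ Suc q\<close> to its value at \<open>u\<close>. It equals
    \<open>exp (\<kappa> * A')\<close> times \<open>u\<close> to the power
    \<open>- \<kappa> * q * A'\<close>, so cost times growth is a constant times \<open>u\<close> to
    the power \<open>c\<close>.\<close>
  define E where "E u = exp (\<kappa> * (- ln u * (q * A') + A'))" for u
  have lim: "((\<lambda>u. C2 * A' ^ (k + 1) * exp (\<kappa> * A') * exp (c * ln u))
      \<longlongrightarrow> C2 * A' ^ (k + 1) * exp (\<kappa> * A') * 0) (at_right 0)"
    by (intro tendsto_intros exp_ln_at_right_0 c)
  have eq: "C2 * A' ^ (k + 1) * exp (\<kappa> * A') * exp (c * ln u) = C2 * (A' * u ^ Suc q) ^ (k + 1) * E u" 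
    if "0 < u" for u
  proof -
    have "u ^ n = exp (n * ln u)" using that by (simp add: exp_of_nat_mult)
    then have 1: "E u * u ^ n = exp (\<kappa> * A') * exp (c * ln u)"
      by (simp add: E_def c_def exp_add[symmetric] algebra_simps)
    have 2: "(A' * u ^ Suc q) ^ (k + 1) = A' ^ (k + 1) * u ^ n"
      unfolding n_def by (simp only: power_mult_distrib power_mult)
    show ?thesis by (simp only: 2 mult.assoc 1[symmetric]) (simp only: ac_simps)
  qed
  have "\<forall>\<^sub>F u in at_right 0. C2 * A' ^ (k + 1) * exp (\<kappa> * A') * exp (c * ln u) < 1/4"
    by (rule order_tendstoD[OF lim]) simp
  then have ev1: "\<forall>\<^sub>F u in at_right 0. C2 * (A' * u ^ Suc q) ^ (k + 1) * E u < 1/4"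
    using eventually_at_right_less[of 0] by eventually_elim (simp only: eq)
  have "((\<lambda>u. C2 * u ^ (k + 1)) \<longlongrightarrow> C2 * 0) (at_right 0)"
    by (intro tendsto_intros power_at_right_0) simp
  then have ev2: "\<forall>\<^sub>F u in at_right 0. C2 * u ^ (k + 1) < 1/4"
    by (rule order_tendstoD) simp
  have lim3: "((\<lambda>u. u + A' * u ^ Suc q) \<longlongrightarrow> 0 + A' * 0) (at_right 0)"
    by (intro tendsto_intros power_at_right_0) simp
  have ev3: "\<forall>\<^sub>F u in at_right 0. u + A' * u ^ Suc q < min b 1"
    by (rule order_tendstoD[OF lim3]) (use b_pos in simp)
  obtain e1 where e1: "0 < e1" "\<And>v. 0 < v \<Longrightarrow> v < e1 \<Longrightarrow> v - H v \<le> A' * v ^ Suc q"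
    using H_lower_bound[OF A'(1)] by blast
  have "\<forall>\<^sub>F u in at_right 0. (\<forall>v\<in>{0<..d}. H v \<le> u \<longrightarrow> v \<le> u + A' * u ^ Suc q) \<and>
      C2 * (A' * u ^ Suc q) ^ (k + 1) * E u < 1/4 \<and> C2 * u ^ (k + 1) < 1/4 \<and>
      u + A' * u ^ Suc q < min b 1"
    using preimage_localized[OF A'(1)] ev1 ev2 ev3 by eventually_elim auto
  then obtain e2 where e2: "0 < e2"
    "\<And>u v. 0 < u \<Longrightarrow> u < e2 \<Longrightarrow> 0 < v \<Longrightarrow> v \<le> d \<Longrightarrow> H v \<le> u \<Longrightarrow> v \<le> u + A' * u ^ Suc q"
    "\<And>u. 0 < u \<Longrightarrow> u < e2 \<Longrightarrow> C2 * (A' * u ^ Suc q) ^ (k + 1) * E u < 1/4"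
    "\<And>u. 0 < u \<Longrightarrow> u < e2 \<Longrightarrow> C2 * u ^ (k + 1) < 1/4"
    "\<And>u. 0 < u \<Longrightarrow> u < e2 \<Longrightarrow> u + A' * u ^ Suc q < min b 1"
    unfolding eventually_at_right_field by auto
  define u0 where "u0 = min e1 e2 / 2"
  have u0: "0 < u0" "u0 < e1" "u0 < e2" using e1(1) e2(1) by (auto simp: u0_def min_def)
  \<comment> \<open>No point beyond \<open>w u\<close> contributes at \<open>u\<close>. The
    iteration therefore runs on \<open>(0, w u0]\<close>, with the piece beyond \<open>u0\<close>
    settled by the choice of \<open>A\<close>.\<close>
  define w where "w u = u + A' * u ^ Suc q" for u
  have w_less: "w u < b" "w u < 1" if "0 < u" "u \<le> u0" for u
    using e2(5)[of u] that u0 by (auto simp: w_def)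
  have w_ge: "u \<le> w u" if "0 < u" for u
    using that A'_pos by (simp add: w_def)
  have w_mono: "w u \<le> w v" if "0 < u" "u \<le> v" for u v
    unfolding w_def using that A'_pos by (intro add_mono mult_left_mono power_mono) auto
  obtain B where B: "0 \<le> B" "\<And>u. 0 < u \<Longrightarrow> u < b \<Longrightarrow> \<psi> u \<le> B"
    using psi_bounded by blast
  \<comment> \<open>Chosen so that \<open>A * comparison \<kappa> u0 = B + 1\<close>, which
    dominates \<psi>.\<close>
  define A where "A = (B + 1) / comparison \<kappa> u0"
  have A_pos: "0 < A" using B comparison_pos[of \<kappa> u0] by (simp add: A_def)
  have base: "\<psi> v \<le> A * comparison \<kappa> v" if v: "u0 < v" "v \<le> w u0" for v
  proof -
    have "\<psi> v \<le> B" using B(2)[of v] w_less[of u0] u0 v by auto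
    also have "\<dots> \<le> A * comparison \<kappa> u0"
      using comparison_pos[of \<kappa> u0] by (simp add: A_def)
    also have "\<dots> \<le> A * comparison \<kappa> v"
      using A_pos l u0 v w_less[of u0] by (intro mult_left_mono comparison_mono) auto
    finally show ?thesis .
  qed
  \<comment> \<open>The kernel maps constants near 0 to at most half of themselves, so the surplus over the
    supersolution is halved at each application of the integral equation.\<close>
  have iter: "\<psi> v \<le> A * comparison \<kappa> v + B / 2 ^ m" if "0 < v" "v \<le> w u0" for v m
    using that
  proof (induction m arbitrary: v)
    case 0
    have "\<psi> v \<le> B" using B(2)[of v] w_less[of u0] u0 0 by auto
    then show ?case using A_pos comparison_pos[of \<kappa> v]
      by (simp add: add_increasing)
  next
    case (Suc m)
    show ?case
    proof (cases "u0 < v")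
      case True
      then show ?thesis using base[of v] Suc.prems B(1) by (simp add: add_increasing2)
    next
      case False
      define \<eta> where "\<eta> = B / 2 ^ m"
      have \<eta>: "0 \<le> \<eta>" using B by (simp add: \<eta>_def)
      have v: "0 < v" "v \<le> u0" "v < 1" "v < b" "v < e2" "v < e1"
        using Suc.prems False w_less[of u0] u0 w_ge[of u0] by auto
      \<comment> \<open>The weights of the values on \<open>(0, v]\<close> and on
        \<open>(v, w v]\<close>. The bounds 1/4 make \<open>T1 + T2 * E v\<close>, which multiplies
        the comparison function, and \<open>T1 + T2\<close>, which multiplies the surplus, at most
        1/2.\<close>
      define T1 T2 where "T1 = C2 * v ^ (k + 1)" and "T2 = C2 * (A' * v ^ Suc q) ^ (k + 1)"
      have T: "0 \<le> T1" "0 \<le> T2" using C2_pos v A'_pos by (auto simp: T1_def T2_def)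
      have T1: "T1 \<le> 1/4" using e2(4)[of v] v by (simp add: T1_def)
      have T2E: "T2 * E v \<le> 1/4" using e2(3)[of v] v by (simp add: T2_def)
      have "0 \<le> - ln v * (q * A') + A'"
        using v A'_pos by (intro add_nonneg_nonneg mult_nonneg_nonneg) auto
      then have "1 \<le> E v"
        unfolding E_def one_le_exp_iff using l by (intro mult_nonneg_nonneg) auto
      then have "T2 * 1 \<le> T2 * E v" using T by (intro mult_left_mono) auto
      then have T2: "T2 \<le> 1/4" using T2E by simp
      have fw: "comparison \<kappa> (w v) \<le> comparison \<kappa> v * E v"
      proof -
        have "ln (w v) / w v ^ q - ln v / v ^ q \<le> - ln v * (q * A') + A'"
          unfolding w_def using v A'_pos by (intro ln_over_power_step_upper) auto
        then have "\<kappa> * (ln (w v) / w v ^ q) \<le> \<kappa> * (ln v / v ^ q + (- ln v * (q * A') + A'))"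
          using l by (intro mult_left_mono) auto
        then show ?thesis
          by (simp only: comparison_def E_def exp_add[symmetric] distrib_left[symmetric] exp_le_cancel_iff)
      qed
      have "\<psi> v \<le> C2 * v ^ k * (v * (A * comparison \<kappa> v + \<eta>)) +
         C2 * (A' * v ^ Suc q) ^ k * ((w v - v) * (A * comparison \<kappa> (w v) + \<eta>))"
      proof (rule step_upper)
        show "v \<le> w v" "w v \<le> d" using w_ge[of v] w_less[of v] v b_le_d by auto
        show "v' \<le> w v" if "0 < v'" "v' \<le> d" "H v' \<le> v" for v'
          unfolding w_def using that v by (intro e2(2)) auto
        show "\<psi> v' \<le> A * comparison \<kappa> v + \<eta>" if "0 < v'" "v' \<le> v" for v'
        proof -
          have "\<psi> v' \<le> A * comparison \<kappa> v' + \<eta>"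
            unfolding \<eta>_def using that Suc.prems by (intro Suc.IH) auto
          also have "A * comparison \<kappa> v' \<le> A * comparison \<kappa> v"
            using that v l A_pos by (intro mult_left_mono comparison_mono) auto
          finally show ?thesis by simp
        qed
        show "\<psi> v' \<le> A * comparison \<kappa> (w v) + \<eta>" if "v < v'" "v' \<le> w v" for v'
        proof -
          have "\<psi> v' \<le> A * comparison \<kappa> v' + \<eta>"
            unfolding \<eta>_def using that v w_mono[of v u0] by (intro Suc.IH) auto
          also have "A * comparison \<kappa> v' \<le> A * comparison \<kappa> (w v)"
            using that v l A_pos w_less[of v] by (intro mult_left_mono comparison_mono) auto
          finally show ?thesis by simp
        qed
        show "v - H v \<le> A' * v ^ Suc q" using e1(2) v by auto
        show "0 \<le> A * comparison \<kappa> v + \<eta>" "0 \<le> A * comparison \<kappa> (w v) + \<eta>"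
          using A_pos comparison_pos[of \<kappa> v] comparison_pos[of \<kappa> "w v"] \<eta> by simp_all
      qed (use v A'_pos in auto)
      also have "\<dots> = T1 * (A * comparison \<kappa> v + \<eta>) + T2 * (A * comparison \<kappa> (w v) + \<eta>)"
        by (simp add: T1_def T2_def w_def)
      also have "\<dots> \<le> T1 * (A * comparison \<kappa> v + \<eta>) + T2 * (A * (comparison \<kappa> v * E v) + \<eta>)"
        using T A_pos fw by (intro add_left_mono mult_left_mono add_right_mono) auto
      also have "\<dots> = (T1 + T2 * E v) * (A * comparison \<kappa> v) + (T1 + T2) * \<eta>"
        by (simp add: algebra_simps)
      also have "\<dots> \<le> 1 * (A * comparison \<kappa> v) + 1/2 * \<eta>"
        using T1 T2 T2E \<eta> A_pos comparison_pos[of \<kappa> v] by (intro add_mono mult_right_mono) auto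
      finally show ?thesis by (simp add: \<eta>_def)
    qed
  qed
  \<comment> \<open>Letting \<open>m\<close> tend to infinity removes the surplus.\<close>
  have "\<psi> v \<le> A * comparison \<kappa> v" if v: "0 < v" "v < u0" for v
  proof (rule tendsto_lowerbound)
    have "((\<lambda>m. A * comparison \<kappa> v + B * (1/2) ^ m) \<longlonglongrightarrow> A * comparison \<kappa> v + B * 0)"
      by (intro tendsto_intros LIMSEQ_realpow_zero) auto
    then show "((\<lambda>m. A * comparison \<kappa> v + B * (1/2) ^ m) \<longlonglongrightarrow> A * comparison \<kappa> v)" by simp
    show "\<forall>\<^sub>F m in sequentially. \<psi> v \<le> A * comparison \<kappa> v + B * (1/2) ^ m"
      using iter[of v] v w_ge[of u0] u0 by (auto simp: power_one_over)
  qed auto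
  then have "\<forall>\<^sub>F v in at_right 0. \<psi> v \<le> A * comparison \<kappa> v"
    unfolding eventually_at_right_field using u0 by blast
  with A_pos show thesis by (rule that)
qed

text \<open>Now growth outweighs cost, so a lower bound on a window slightly above \<open>u\<close>
  passes to \<open>u\<close> with the same constant \<open>a\<close>. Starting from a fixed
  interval, the bound is carried to any \<open>s > 0\<close> in finitely many steps; their number
  depends on \<open>s\<close>, but \<open>a\<close> does not.\<close>

lemma psi_ge_comparison:
  assumes L: "Suc q * (k + 1) < \<kappa> * (\<alpha> * q)"
  obtains a where "0 < a" "\<forall>\<^sub>F u in at_right 0. a * comparison \<kappa> u \<le> \<psi> u"
proof -
  have "0 < \<kappa> * (\<alpha> * q)" using L of_nat_0_le_iff order.strict_trans1 by blast
  then have l: "0 < \<kappa>" using alpha_pos by (auto simp: zero_less_mult_iff mult_less_0_iff)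
  then have lq: "0 < \<kappa> * q" using q_pos by simp
  define n where "n = Suc q * (k + 1)"
  have "n / (\<kappa> * q) < \<alpha>"
    using L lq by (simp add: n_def pos_divide_less_eq ac_simps)
  \<comment> \<open>In the chain \<open>A0 < A' < A'' < A3 < \<alpha>\<close>, \<open>A'\<close> and
    \<open>A''\<close> fix the two ends of the window above \<open>u\<close>, and \<open>A3\<close>
    bounds \<open>v - H v\<close> from below. The gap \<open>A'' - A'\<close> gives the length of
    the window, \<open>A3 - A''\<close> gives the weight on it, and the gap between
    \<open>A0\<close> and \<open>A'\<close> absorbs the denominator in
    \<open>ln_over_power_step_lower\<close>.\<close>
  then obtain A0 where A0: "n / (\<kappa> * q) < A0" "A0 < \<alpha>" using dense by blast
  obtain A' where A': "A0 < A'" "A' < \<alpha>" using A0 dense by blast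
  obtain A'' where A'': "A' < A''" "A'' < \<alpha>" using A' dense by blast
  obtain A3 where A3: "A'' < A3" "A3 < \<alpha>" using A'' dense by blast
  have "0 \<le> n / (\<kappa> * q)" using lq by simp
  then have pos: "0 < A0" "0 < A'" "0 < A''" "0 < A3" using A0 A' A'' A3 by linarith+
  define c where "c = \<kappa> * q * A0 - n"
  have c: "0 < c"
    using A0 lq by (simp add: c_def pos_divide_less_eq ac_simps)
  define K where "K = C1 * (A3 - A'') ^ k * (A'' - A')"
  have K: "0 < K" using C1_pos A3 A'' by (simp add: K_def)
  have "\<forall>\<^sub>F u in at_right 0. exp (c * ln u) < K"
    by (rule order_tendstoD(2)[OF exp_ln_at_right_0[OF c] K])
  then have ev1: "\<forall>\<^sub>F u in at_right 0. exp (c * ln u) \<le> K"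
    by eventually_elim simp
  \<comment> \<open>The right-hand side equals \<open>K * exp (- (c * ln u))\<close>, which blows up
    at 0: one step costs \<open>u ^ n\<close> times \<open>K\<close> and gains \<open>u\<close> to
    the power \<open>- \<kappa> * q * A0\<close>.\<close>
  have gain: "1 \<le> C1 * ((A3 - A'') * u ^ Suc q) ^ k * ((A'' - A') * u ^ Suc q) * exp (\<kappa> * (- ln u * (q * A0)))"
    if u: "0 < u" "exp (c * ln u) \<le> K" for u
  proof -
    have "u ^ n = exp (n * ln u)" using u by (simp add: exp_of_nat_mult)
    then have "u ^ n * exp (\<kappa> * (- ln u * (q * A0))) = exp (- (c * ln u))"
      by (simp add: c_def exp_add[symmetric] algebra_simps)
    moreover have "((A3 - A'') * u ^ Suc q) ^ k * ((A'' - A') * u ^ Suc q) = (A3 - A'') ^ k * (A'' - A') * u ^ n"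
    proof -
      have "n = Suc q * k + Suc q" by (simp add: n_def)
      then have un: "u ^ n = (u ^ Suc q) ^ k * u ^ Suc q" by (simp only: power_mult power_add)
      show ?thesis unfolding un power_mult_distrib[of "A3 - A''"] by (simp only: ac_simps)
    qed
    ultimately have "C1 * ((A3 - A'') * u ^ Suc q) ^ k * ((A'' - A') * u ^ Suc q) * exp (\<kappa> * (- ln u * (q * A0)))
       = K * exp (- (c * ln u))"
      by (simp only: K_def mult.assoc)
    moreover have "exp (c * ln u) * exp (- (c * ln u)) \<le> K * exp (- (c * ln u))"
      using u by (intro mult_right_mono) auto
    ultimately show ?thesis by (simp add: exp_minus)
  qed
  have "((\<lambda>u. A' / (1 + q * A' * u ^ q)) \<longlongrightarrow> A' / (1 + q * A' * 0)) (at_right 0)"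
    by (intro tendsto_intros power_at_right_0 q_pos) auto
  then have ev2: "\<forall>\<^sub>F u in at_right 0. A0 < A' / (1 + q * A' * u ^ q)"
    by (rule order_tendstoD) (use A' in simp)
  obtain e1 where e1: "0 < e1" "\<And>v. 0 < v \<Longrightarrow> v < e1 \<Longrightarrow> A3 * v ^ Suc q \<le> v - H v"
    using H_upper_bound[OF A3(2)] by blast
  have lim3: "((\<lambda>u. u + A'' * u ^ Suc q) \<longlongrightarrow> 0 + A'' * 0) (at_right 0)"
    by (intro tendsto_intros power_at_right_0) simp
  have ev3: "\<forall>\<^sub>F u in at_right 0. u + A'' * u ^ Suc q < min e1 (min b 1)"
    by (rule order_tendstoD[OF lim3]) (use b_pos e1 in simp)
  have "\<forall>\<^sub>F u in at_right 0. exp (c * ln u) \<le> K \<and> A0 < A' / (1 + q * A' * u ^ q) \<and>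
      u + A'' * u ^ Suc q < min e1 (min b 1)"
    using ev1 ev2 ev3 by eventually_elim auto
  then obtain e2 where e2: "0 < e2"
    "\<And>u. 0 < u \<Longrightarrow> u < e2 \<Longrightarrow> exp (c * ln u) \<le> K"
    "\<And>u. 0 < u \<Longrightarrow> u < e2 \<Longrightarrow> A0 < A' / (1 + q * A' * u ^ q)"
    "\<And>u. 0 < u \<Longrightarrow> u < e2 \<Longrightarrow> u + A'' * u ^ Suc q < min e1 (min b 1)"
    unfolding eventually_at_right_field by auto
  define u0 where "u0 = e2 / 2"
  have u0: "0 < u0" "u0 < e2" using e2(1) by (auto simp: u0_def)
  define w where "w u = u + A'' * u ^ Suc q" for u
  have w_less: "w u < b" "w u < 1" "w u < e1" if "0 < u" "u \<le> u0" for u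
    using e2(4)[of u] that u0 by (auto simp: w_def)
  have w_ge: "u \<le> w u" if "0 < u" for u
    using that pos by (simp add: w_def)
  have w_mono: "w u \<le> w v" if "0 < u" "u \<le> v" for u v
    unfolding w_def using that pos by (intro add_mono mult_left_mono power_mono) auto
  \<comment> \<open>This makes the threshold \<open>H (u0 / 2) + u0 / 2\<close> of
    \<open>psi_lower_const\<close> at most \<open>u0\<close>, so the constant lower bound holds from
    \<open>u0\<close> on.\<close>
  have H_less: "H (u0 / 2) \<le> u0 / 2"
  proof -
    have "0 \<le> A3 * (u0 / 2) ^ Suc q" using pos u0 by simp
    moreover have "A3 * (u0 / 2) ^ Suc q \<le> u0 / 2 - H (u0 / 2)"
      using u0 w_ge[of u0] w_less[of u0] by (intro e1(2)) auto
    ultimately show ?thesis by linarith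
  qed
  obtain a where a: "0 < a" "\<And>u. 0 < u \<Longrightarrow> u < b \<Longrightarrow> H (u0 / 2) + u0 / 2 \<le> u \<Longrightarrow> a \<le> \<psi> u"
    using psi_lower_const[of "u0 / 2" "u0 / 2"] u0 w_ge[of u0] w_less[of u0] b_le_d by auto
  have base: "a * comparison \<kappa> u \<le> \<psi> u" if u: "u0 \<le> u" "u \<le> w u0" for u
  proof -
    have "a * comparison \<kappa> u \<le> a * 1"
      using a l u u0 w_less[of u0] by (intro mult_left_mono comparison_le_1) auto
    also have "\<dots> \<le> \<psi> u" using a(2)[of u] u u0 w_less[of u0] H_less by auto
    finally show ?thesis .
  qed
  have step: "a * comparison \<kappa> u \<le> \<psi> u"
    if u: "0 < u" "u \<le> u0" and IH: "\<And>v. u + A' * u ^ Suc q \<le> v \<Longrightarrow> v \<le> w u \<Longrightarrow> a * comparison \<kappa> v \<le> \<psi> v" for u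
  proof -
    have u': "u < e2" "u < 1" "u < b" "u < e1" using u u0 w_less[of u] w_ge[of u] by auto
    define s where "s = u + A' * u ^ Suc q"
    define D where "D = (A3 - A'') * u ^ Suc q"
    have s: "u \<le> s" "s \<le> w u" using u pos A''(1) by (auto simp: s_def w_def intro!: mult_right_mono)
    have D: "0 \<le> D" using u A3 by (simp add: D_def)
    \<comment> \<open>Even the far end of the window is mapped below \<open>u\<close> by the margin
      \<open>D\<close>, since \<open>H\<close> moves it down by at least
      \<open>A3 * u ^ Suc q\<close> while it lies only \<open>A'' * u ^ Suc q\<close> above
      \<open>u\<close>.\<close>
    have Hw: "H (w u) \<le> u - D"
    proof -
      have "A3 * u ^ Suc q \<le> A3 * w u ^ Suc q"
        using pos u w_ge[of u] by (intro mult_left_mono power_mono) auto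
      also have "\<dots> \<le> w u - H (w u)" using u w_ge[of u] w_less[of u] by (intro e1(2)) auto
      finally show ?thesis by (simp add: D_def w_def algebra_simps)
    qed
    have "comparison \<kappa> u * exp (\<kappa> * (- ln u * (q * A0))) \<le> comparison \<kappa> s"
    proof -
      have "- ln u * (q * A0) \<le> - ln u * (q * (A' / (1 + q * A' * u ^ q)))"
        using e2(3)[of u] u u' by (intro mult_left_mono) auto
      also have "\<dots> \<le> ln s / s ^ q - ln u / u ^ q"
        unfolding s_def using u u' pos by (intro ln_over_power_step_lower) auto
      finally have "\<kappa> * (ln u / u ^ q + - ln u * (q * A0)) \<le> \<kappa> * (ln s / s ^ q)"
        using l by (intro mult_left_mono) auto
      then show ?thesis
        by (simp only: comparison_def exp_add[symmetric] distrib_left[symmetric] exp_le_cancel_iff)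
    qed
    then have f: "a * comparison \<kappa> u * exp (\<kappa> * (- ln u * (q * A0))) \<le> a * comparison \<kappa> s"
      using a by (simp add: mult.assoc)
    have "a * comparison \<kappa> u * 1 \<le> a * comparison \<kappa> u * 
        (C1 * D ^ k * ((A'' - A') * u ^ Suc q) * exp (\<kappa> * (- ln u * (q * A0))))"
      unfolding D_def using a comparison_pos[of \<kappa> u] gain[OF u(1) e2(2)] u u'
      by (intro mult_left_mono) auto
    also have "\<dots> = C1 * D ^ k * ((A'' - A') * u ^ Suc q) * 
        (a * comparison \<kappa> u * exp (\<kappa> * (- ln u * (q * A0))))"
      by (simp only: ac_simps)
    also have "\<dots> \<le> C1 * D ^ k * ((A'' - A') * u ^ Suc q) * (a * comparison \<kappa> s)"
      using f C1_pos D A'' u by (intro mult_left_mono) auto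
    also have "\<dots> = C1 * D ^ k * ((w u - s) * (a * comparison \<kappa> s))"
      by (simp add: w_def s_def algebra_simps)
    also have "\<dots> \<le> \<psi> u"
    proof (rule step_lower)
      show "w u \<le> d" using w_less[of u] u b_le_d by simp
      show "a * comparison \<kappa> s \<le> \<psi> v" if "s \<le> v" "v \<le> w u" for v
      proof -
        have "a * comparison \<kappa> s \<le> a * comparison \<kappa> v"
          using that a l u s w_less[of u] by (intro mult_left_mono comparison_mono) auto
        also have "\<dots> \<le> \<psi> v" using that by (intro IH) (auto simp: s_def)
        finally show ?thesis .
      qed
    qed (use u u' s Hw D a comparison_pos[of \<kappa> s] in auto)
    finally show ?thesis by simp
  qed
  have "a * comparison \<kappa> s \<le> \<psi> s" if s: "0 < s" "s < u0" for s
  proof -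
    \<comment> \<open>For every \<open>u \<ge> s\<close> the window starts at least \<delta> above
      \<open>u\<close>, so each use of \<open>step\<close> extends the bound downwards by \<delta>.
      The starting interval reaches \<open>w u0\<close>, hence contains the part above
      \<open>u0\<close> of each window that is used.\<close>
    define \<delta> where "\<delta> = A' * s ^ Suc q"
    have \<delta>: "0 < \<delta>" using s pos by (simp add: \<delta>_def)
    have march: "a * comparison \<kappa> u \<le> \<psi> u" if "s \<le> u" "u \<le> w u0" "u0 - real m * \<delta> \<le> u" for u m
      using that
    proof (induction m arbitrary: u)
      case 0
      then show ?case using base by simp
    next
      case (Suc m)
      show ?case
      proof (cases "u0 \<le> u")
        case True
        then show ?thesis using base Suc.prems by simp
      next
        case False
        have "\<delta> \<le> A' * u ^ Suc q" unfolding \<delta>_def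
          using Suc.prems s pos by (intro mult_left_mono power_mono) auto
        show ?thesis
        proof (rule step)
          fix v assume "u + A' * u ^ Suc q \<le> v" "v \<le> w u"
          then show "a * comparison \<kappa> v \<le> \<psi> v"
            using \<open>\<delta> \<le> _\<close> False Suc.prems s w_mono[of u u0] \<delta>
            by (intro Suc.IH) (auto simp: distrib_right simp del: power_Suc)
        qed (use False Suc.prems s in auto)
      qed
    qed
    obtain m where "u0 / \<delta> < real m" using reals_Archimedean2 by blast
    then have "u0 - real m * \<delta> \<le> s" using \<delta> s by (simp add: pos_divide_less_eq)
    then show ?thesis using march[of s m] s u0 w_ge[of u0] by auto
  qed
  then have "\<forall>\<^sub>F s in at_right 0. a * comparison \<kappa> s \<le> \<psi> s"
    unfolding eventually_at_right_field using u0 by blast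
  with a(1) show thesis by (rule that)
qed

text \<open>A constant factor contributes \<open>u ^ q * ln a / ln u\<close>, which vanishes in the
  limit, so comparison with exponent \<kappa> bounds the ratio by \<kappa> up to an error tending to
  0. As \<open>ln u < 0\<close>, upper bounds for \<psi> become lower bounds for the ratio and
  conversely.\<close>

theorem ln_psi_asymptotics:
  "((\<lambda>u. u ^ q * ln (\<psi> u) / ln u) \<longlongrightarrow> Suc q * (k + 1) / (\<alpha> * q)) (at_right 0)"
proof -
  have aq: "0 < \<alpha> * q" using alpha_pos q_pos by simp
  \<comment> \<open>Any large exponent serves here: the point is that \<psi> is positive near 0, so
    that \<open>ln\<close> is monotone on the values compared.\<close>
  obtain a0 \<kappa>0 where a0: "0 < a0" "\<forall>\<^sub>F u in at_right 0. a0 * comparison \<kappa>0 u \<le> \<psi> u"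
  proof -
    obtain l where "Suc q * (k + 1) / (\<alpha> * q) < l" using gt_ex by blast
    then have "Suc q * (k + 1) < l * (\<alpha> * q)" using aq by (simp add: pos_divide_less_eq)
    then show thesis using psi_ge_comparison[of l] that by blast
  qed
  have psi_pos: "\<forall>\<^sub>F u in at_right 0. 0 < \<psi> u"
    using a0(2) 
  proof eventually_elim
    case (elim u)
    have "0 < a0 * comparison \<kappa>0 u" using a0(1) comparison_pos by simp
    then show ?case using elim by simp
  qed
  have ev_1: "\<forall>\<^sub>F u::real in at_right 0. 0 < u \<and> u < 1"
    unfolding eventually_at_right_field by (intro exI[of _ 1]) auto
  have lim: "((\<lambda>u. u ^ q * ln a / ln u + \<kappa>) \<longlongrightarrow> \<kappa>) (at_right 0)" for a \<kappa> :: real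
  proof -
    have "((\<lambda>u. 1 / ln u) \<longlongrightarrow> 0) (at_right (0::real))" by real_asymp
    then have "((\<lambda>u. u ^ q * ln a * (1 / ln u) + \<kappa>) \<longlongrightarrow> 0 * ln a * 0 + \<kappa>) (at_right 0)"
      by (intro tendsto_intros power_at_right_0 q_pos)
    then show ?thesis by simp
  qed
  have ratio: "u ^ q * ln (a * comparison \<kappa> u) / ln u = u ^ q * ln a / ln u + \<kappa>"
    if "0 < a" "0 < u" "u < 1" for a u \<kappa>
  proof -
    have "ln (a * comparison \<kappa> u) = ln a + \<kappa> * (ln u / u ^ q)"
      using that comparison_pos[of \<kappa> u] by (simp add: ln_mult comparison_def)
    moreover have "ln u \<noteq> 0" using that by simp
    ultimately show ?thesis using that by (simp add: field_simps)
  qed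
  show ?thesis
  proof (rule order_tendstoI)
    fix x :: real assume x: "x < Suc q * (k + 1) / (\<alpha> * q)"
    \<comment> \<open>The upper comparison requires a positive exponent, whereas \<open>x\<close>
      may be negative.\<close>
    have "max 0 x < Suc q * (k + 1) / (\<alpha> * q)" using x aq by (simp del: of_nat_Suc of_nat_mult)
    then obtain \<kappa> where l: "max 0 x < \<kappa>" "\<kappa> < Suc q * (k + 1) / (\<alpha> * q)" using dense by blast
    have "\<kappa> * (\<alpha> * q) < Suc q * (k + 1)" using l aq by (simp add: pos_less_divide_eq)
    then obtain A where A: "0 < A" "\<forall>\<^sub>F u in at_right 0. \<psi> u \<le> A * comparison \<kappa> u"
      using psi_le_comparison[of \<kappa>] l by auto
    have "\<forall>\<^sub>F u in at_right 0. x < u ^ q * ln A / ln u + \<kappa>"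
      by (rule order_tendstoD[OF lim]) (use l in simp)
    then show "\<forall>\<^sub>F u in at_right 0. x < u ^ q * ln (\<psi> u) / ln u"
      using A(2) psi_pos ev_1
    proof eventually_elim
      case (elim u)
      have "ln (\<psi> u) \<le> ln (A * comparison \<kappa> u)"
        using elim A(1) comparison_pos[of \<kappa> u] by simp
      then have "u ^ q * ln (A * comparison \<kappa> u) / ln u \<le> u ^ q * ln (\<psi> u) / ln u"
        using elim by (intro divide_right_mono_neg mult_left_mono) auto
      then show ?case using elim ratio[of A u \<kappa>] A by simp
    qed
  next
    fix x :: real assume x: "Suc q * (k + 1) / (\<alpha> * q) < x"
    then obtain \<kappa> where l: "\<kappa> < x" "Suc q * (k + 1) / (\<alpha> * q) < \<kappa>" using dense by blast
    have "Suc q * (k + 1) < \<kappa> * (\<alpha> * q)" using l aq by (simp add: pos_divide_less_eq)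
    then obtain a where a: "0 < a" "\<forall>\<^sub>F u in at_right 0. a * comparison \<kappa> u \<le> \<psi> u"
      using psi_ge_comparison[of \<kappa>] l by auto
    have "\<forall>\<^sub>F u in at_right 0. u ^ q * ln a / ln u + \<kappa> < x"
      by (rule order_tendstoD[OF lim]) (use l in simp)
    then show "\<forall>\<^sub>F u in at_right 0. u ^ q * ln (\<psi> u) / ln u < x"
      using a(2) psi_pos ev_1
    proof eventually_elim
      case (elim u)
      have "ln (a * comparison \<kappa> u) \<le> ln (\<psi> u)"
        using elim a(1) comparison_pos[of \<kappa> u] by simp
      then have "u ^ q * ln (\<psi> u) / ln u \<le> u ^ q * ln (a * comparison \<kappa> u) / ln u"
        using elim by (intro divide_right_mono_neg mult_left_mono) auto
      then show ?case using elim ratio[of a u \<kappa>] a by simp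
    qed
  qed
qed

end

section \<open>Reduction of the transfer operator\<close>

text \<open>Restricting the total derivative to the vertical fibre gives its value at
  \<open>(0, 1)\<close>. Derivatives within the nondegenerate interval \<open>Delta\<close> are
  unique, so \<open>partial_w\<close> is this value and inherits joint continuity.\<close>

lemma C1_on_partial_w:
  assumes "C1_on (X \<times> Delta) h"
  shows "\<And>x w. x \<in> X \<Longrightarrow> w \<in> Delta \<Longrightarrow>
      ((\<lambda>w. h (x, w)) has_vector_derivative partial_w h x w) (at w within Delta)"
    and "continuous_on (X \<times> Delta) (\<lambda>(x, w). partial_w h x w)"
proof -
  obtain h' where h': "\<And>z. z \<in> X \<times> Delta \<Longrightarrow> (h has_derivative blinfun_apply (h' z)) (at z within X \<times> Delta)"
    and cont: "continuous_on (X \<times> Delta) h'"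
    using assms unfolding C1_on_def by blast
  have der: "((\<lambda>w. h (x, w)) has_vector_derivative h' (x, w) (0, 1)) (at w within Delta)"
    if "x \<in> X" "w \<in> Delta" for x w
  proof -
    have "((\<lambda>w. (x, w)) has_derivative (\<lambda>t. (0, t))) (at w within Delta)"
      by (auto intro!: derivative_eq_intros)
    moreover have "(h has_derivative blinfun_apply (h' (x, w))) (at (x, w) within Pair x ` Delta)"
      using that by (intro has_derivative_subset[OF h']) auto
    ultimately have *: "((\<lambda>w. h (x, w)) has_derivative (\<lambda>t. h' (x, w) (0, t))) (at w within Delta)"
      by (rule has_derivative_in_compose)
    have "(\<lambda>t. h' (x, w) (0, t)) = (\<lambda>t. t *\<^sub>R h' (x, w) (0, 1))"
    proof
      fix t show "h' (x, w) (0, t) = t *\<^sub>R h' (x, w) (0, 1)"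
        using blinfun.scaleR_right[of "h' (x, w)" t "(0, 1)"] by simp
    qed
    with * show ?thesis unfolding has_vector_derivative_def by (rule has_derivative_eq_rhs)
  qed
  have eq: "partial_w h x w = h' (x, w) (0, 1)" if "x \<in> X" "w \<in> Delta" for x w
    unfolding partial_w_def using that der by (intro vector_derivative_within_closed_interval) auto
  show "((\<lambda>w. h (x, w)) has_vector_derivative partial_w h x w) (at w within Delta)"
    if "x \<in> X" "w \<in> Delta" for x w
    using der that eq by simp
  have "continuous_on (X \<times> Delta) (\<lambda>z. h' z (0, 1))"
    by (intro continuous_intros cont)
  then show "continuous_on (X \<times> Delta) (\<lambda>(x, w). partial_w h x w)"
    by (rule continuous_on_eq) (auto simp: eq)
qed

text \<open>Differentiability is enough: \<open>vector_derivative\<close> selects a derivative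
  whenever one exists, and monotonicity in \<open>x\<close> uses only its sign.\<close>

lemma C1_on_partial_x:
  assumes "C1_on (X \<times> Delta) h" "x \<in> X" "w \<in> Delta"
  shows "((\<lambda>x. h (x, w)) has_vector_derivative partial_x X h x w) (at x within X)"
proof -
  obtain h' where h': "\<And>z. z \<in> X \<times> Delta \<Longrightarrow> (h has_derivative blinfun_apply (h' z)) (at z within X \<times> Delta)"
    using assms unfolding C1_on_def by blast
  have "((\<lambda>x. (x, w)) has_derivative (\<lambda>t. (t, 0))) (at x within X)"
    by (auto intro!: derivative_eq_intros)
  moreover have "(h has_derivative blinfun_apply (h' (x, w))) (at (x, w) within (\<lambda>x. (x, w)) ` X)"
    using assms by (intro has_derivative_subset[OF h']) auto
  ultimately have "((\<lambda>x. h (x, w)) has_derivative (\<lambda>t. h' (x, w) (t, 0))) (at x within X)"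
    by (rule has_derivative_in_compose)
  then have "(\<lambda>x. h (x, w)) differentiable at x within X"
    unfolding differentiable_def by blast
  then show ?thesis unfolding partial_x_def by (simp add: vector_derivative_works)
qed

lemma C1_on_imp_continuous_on:
  assumes "C1_on S f" shows "continuous_on S f"
proof -
  obtain f' where "\<And>z. z \<in> S \<Longrightarrow> (f has_derivative blinfun_apply (f' z)) (at z within S)"
    using assms unfolding C1_on_def by blast
  then show ?thesis by (rule has_derivative_continuous_on)
qed

lemma H1_strict_mono_x:
  assumes "is_interval X" "C1_on (X \<times> Delta) h" "H1 X h" "w \<in> Delta" "x \<in> X" "y \<in> X" "x < y"
  shows "h (x, w) < h (y, w)"
proof -
  have sub: "{x..y} \<subseteq> X" using assms by (meson atLeastAtMost_iff mem_is_interval_1_I subsetI)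
  have "\<exists>z\<in>{x<..<y}. h (y, w) - h (x, w) = (y - x) *\<^sub>R partial_x X h z w"
  proof (rule mvt_simple[OF \<open>x < y\<close>])
    fix z assume "x \<le> z" "z \<le> y"
    then have "z \<in> X" using sub by auto
    show "((\<lambda>x. h (x, w)) has_derivative (\<lambda>t. t *\<^sub>R partial_x X h z w)) (at z within {x..y})"
      using C1_on_partial_x[OF assms(2) \<open>z \<in> X\<close> assms(4)] sub
      unfolding has_vector_derivative_def by (rule has_derivative_subset)
  qed
  then obtain z where "z \<in> {x<..<y}" "h (y, w) - h (x, w) = (y - x) * partial_x X h z w" by auto
  moreover have "z \<in> X" using sub calculation by auto
  then have "partial_x X h z w > 0"
    using assms(3,4) by (auto simp: H1_def)
  ultimately show ?thesis using \<open>x < y\<close> by (metis diff_gt_0_iff_gt mult_pos_pos)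
qed

lemma mvt_w:
  assumes "C1_on (X \<times> Delta) h" "x \<in> X" "w \<in> Delta" "w' \<in> Delta" "w \<le> w'"
  obtains z where "z \<in> Delta" "h (x, w') - h (x, w) = partial_w h x z * (w' - w)"
proof -
  have "\<exists>z\<in>{w..w'}. h (x, w') - h (x, w) = (w' - w) *\<^sub>R partial_w h x z"
  proof (rule mvt_very_simple[OF \<open>w \<le> w'\<close>])
    fix z assume z: "w \<le> z" "z \<le> w'"
    then have "z \<in> Delta" using assms by auto
    then show "((\<lambda>w. h (x, w)) has_derivative (\<lambda>t. t *\<^sub>R partial_w h x z)) (at z within {w..w'})"
      using C1_on_partial_w(1)[OF assms(1,2)] assms(3,4)
      unfolding has_vector_derivative_def by (auto intro: has_derivative_subset[where s = Delta])
  qed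
  then obtain z where "z \<in> {w..w'}" "h (x, w') - h (x, w) = partial_w h x z * (w' - w)"
    by auto
  then show thesis using assms(3,4) by (intro that[of z]) auto
qed

lemma H1_strict_mono_w:
  assumes "C1_on (X \<times> Delta) h" "H1 X h" "x \<in> X" "w \<in> Delta" "w' \<in> Delta" "w < w'"
  shows "h (x, w) < h (x, w')"
proof -
  obtain z where z: "z \<in> Delta" "h (x, w') - h (x, w) = partial_w h x z * (w' - w)"
    using mvt_w[OF assms(1,3,4,5)] assms(6) by auto
  have "0 < partial_w h x z" using assms(2,3) z(1) by (auto simp: H1_def)
  then have "0 < h (x, w') - h (x, w)" unfolding z(2) using assms(6) by simp
  then show ?thesis by simp
qed

lemma fibre_inv_props:
  assumes "C1_on (X \<times> Delta) h" "H1 X h" "y \<in> X" "h (y, -1) \<le> x" "x \<le> h (y, 1)"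
  shows "fibre_inv h y x \<in> Delta" "h (y, fibre_inv h y x) = x"
proof -
  have cont: "continuous_on {-1..1} (\<lambda>w. h (y, w))"
    by (rule continuous_on_compose2[OF C1_on_imp_continuous_on[OF assms(1)]])
      (use assms(3) in \<open>auto intro!: continuous_intros\<close>)
  obtain w where "-1 \<le> w" "w \<le> 1" "h (y, w) = x"
    using IVT'[of "\<lambda>w. h (y, w)" "-1" x 1] assms(4,5) cont by auto
  then have w: "x \<in> (\<lambda>w. h (y, w)) ` Delta" by auto
  have inj: "inj_on (\<lambda>w. h (y, w)) Delta"
    by (intro strict_mono_on_imp_inj_on strict_mono_onI H1_strict_mono_w[OF assms(1-3)])
  show "fibre_inv h y x \<in> Delta"
    unfolding fibre_inv_def using the_inv_into_into[OF inj w] by blast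
  show "h (y, fibre_inv h y x) = x"
    unfolding fibre_inv_def using f_the_inv_into_f[OF inj w] .
qed

section \<open>The noise density near 1 and the size of the transfer kernel\<close>

lemma Ck_on_imp_continuous_on:
  assumes "Ck_on n S f" shows "continuous_on S f"
proof (cases n)
  case 0
  then show ?thesis using assms by simp
next
  case (Suc m)
  then obtain f' where "\<And>x. x \<in> S \<Longrightarrow> (f has_real_derivative f' x) (at x within S)"
    using assms by auto
  then show ?thesis by (rule DERIV_continuous_on)
qed

lemma H2_near_1:
  assumes "H2 \<nu> p k"
  obtains \<beta> e where "0 < \<beta>" "0 < e"
    "\<And>w. w \<in> Delta \<Longrightarrow> 1 - w < e \<Longrightarrow> \<beta> / 2 * (1 - w) ^ k \<le> p w \<and> p w \<le> 2 * \<beta> * (1 - w) ^ k"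
proof -
  obtain \<beta> where \<beta>: "0 < \<beta>" "(\<lambda>w. p w - \<beta> * (1 - w) ^ k) \<in> o[at_left 1](\<lambda>w. (1 - w) ^ k)"
    and cont: "continuous_on Delta p"
    using assms Ck_on_imp_continuous_on unfolding H2_def by blast
  have "\<forall>\<^sub>F w in at_left 1. norm (p w - \<beta> * (1 - w) ^ k) \<le> \<beta> / 2 * norm ((1 - w) ^ k)"
    using \<beta> by (intro landau_o.smallD) auto
  moreover have "\<forall>\<^sub>F w in at_left (1::real). w < 1" by (simp add: eventually_at_filter)
  ultimately have ev: "\<forall>\<^sub>F w in at_left 1. \<beta> / 2 * (1 - w) ^ k \<le> p w \<and> p w \<le> 2 * \<beta> * (1 - w) ^ k"
  proof eventually_elim
    case (elim w)
    have "0 \<le> (1 - w) ^ k" using elim by simp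
    then have "0 \<le> \<beta> * (1 - w) ^ k" using \<beta> by simp
    moreover have "\<bar>p w - \<beta> * (1 - w) ^ k\<bar> \<le> \<beta> * (1 - w) ^ k / 2"
      using elim by simp
    ultimately have "\<beta> * (1 - w) ^ k / 2 \<le> p w" "p w \<le> 2 * (\<beta> * (1 - w) ^ k)"
      by linarith+
    then show ?case by (simp add: mult.assoc)
  qed
  then obtain c where c: "c < 1"
    "\<And>w. c < w \<Longrightarrow> w < 1 \<Longrightarrow> \<beta> / 2 * (1 - w) ^ k \<le> p w \<and> p w \<le> 2 * \<beta> * (1 - w) ^ k"
    unfolding eventually_at_left_field by blast
  \<comment> \<open>The expansion says nothing at 1 itself, where \<open>(1 - w) ^ k\<close> is 1
    for \<open>k = 0\<close> and 0 otherwise. Continuity of \<open>p\<close> carries both bounds to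
    the endpoint.\<close>
  have lim: "(p \<longlongrightarrow> p 1) (at_left 1)"
    using bspec[OF cont[unfolded continuous_on_def], of 1] at_within_Icc_at_left[of "-1" "1::real"]
    by simp
  have l1: "\<beta> / 2 * (1 - 1) ^ k \<le> p 1"
  proof (rule tendsto_le[OF _ lim])
    show "((\<lambda>w. \<beta> / 2 * (1 - w) ^ k) \<longlongrightarrow> \<beta> / 2 * (1 - 1) ^ k) (at_left 1)"
      by (intro tendsto_intros)
    show "\<forall>\<^sub>F w in at_left 1. \<beta> / 2 * (1 - w) ^ k \<le> p w"
      using ev by (rule eventually_mono) simp
  qed simp
  have l2: "p 1 \<le> 2 * \<beta> * (1 - 1) ^ k"
  proof (rule tendsto_le[OF _ _ lim])
    show "((\<lambda>w. 2 * \<beta> * (1 - w) ^ k) \<longlongrightarrow> 2 * \<beta> * (1 - 1) ^ k) (at_left 1)"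
      by (intro tendsto_intros)
    show "\<forall>\<^sub>F w in at_left 1. p w \<le> 2 * \<beta> * (1 - w) ^ k"
      using ev by (rule eventually_mono) simp
  qed simp
  show thesis
  proof (rule that[of \<beta> "1 - c"])
    fix w assume "w \<in> Delta" "1 - w < 1 - c"
    then show "\<beta> / 2 * (1 - w) ^ k \<le> p w \<and> p w \<le> 2 * \<beta> * (1 - w) ^ k"
      using c(2)[of w] l1 l2 by (cases "w = 1") auto
  qed (use \<beta> c in auto)
qed

text \<open>If \<open>h (y, w) = x\<close>, the mean value theorem writes
  \<open>h (y, 1) - x\<close> as \<open>1 - w\<close> times a value of \<open>partial_w\<close>. On
  the compact set \<open>{a..z} \<times> Delta\<close> these values lie between positive constants,
  so \<open>(1 - w) ^ k\<close> may be traded for \<open>(h (y, 1) - x) ^ k\<close>.\<close>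

lemma stationary_kernel_bounds:
  assumes C1: "C1_on (X \<times> Delta) h" and H1: "H1 X h" and H2: "H2 \<nu> p k" and sub: "{a..z} \<subseteq> X"
  obtains c1 c2 e where "0 < c1" "0 < c2" "0 < e"
    "\<And>x y. y \<in> {a..z} \<Longrightarrow> h (y, -1) \<le> x \<Longrightarrow> x \<le> h (y, 1) \<Longrightarrow> h (y, 1) - x < e \<Longrightarrow>
      c1 * (h (y, 1) - x) ^ k \<le> p (fibre_inv h y x) / partial_w h y (fibre_inv h y x) \<and>
      p (fibre_inv h y x) / partial_w h y (fibre_inv h y x) \<le> c2 * (h (y, 1) - x) ^ k"
proof (cases "a \<le> z")
  case False
  then show thesis using that[of 1 1 1] by auto
next
  case True
  define P where "P = (\<lambda>(x, w). partial_w h x w)"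
  have cont: "continuous_on ({a..z} \<times> Delta) P" unfolding P_def
    by (rule continuous_on_subset[OF C1_on_partial_w(2)[OF C1]]) (use sub in auto)
  have comp: "compact ({a..z} \<times> Delta)" by (intro compact_Times) auto
  have ne: "{a..z} \<times> Delta \<noteq> {}" using True by auto
  obtain s where s: "s \<in> {a..z} \<times> Delta" "\<And>t. t \<in> {a..z} \<times> Delta \<Longrightarrow> P s \<le> P t"
    using continuous_attains_inf[OF comp ne cont] by blast
  obtain S where S: "S \<in> {a..z} \<times> Delta" "\<And>t. t \<in> {a..z} \<times> Delta \<Longrightarrow> P t \<le> P S"
    using continuous_attains_sup[OF comp ne cont] by blast
  define m where "m = P s"
  define n where "n = P S"
  have m: "0 < m" using s(1) sub H1 by (auto simp: m_def P_def H1_def)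
  have n: "0 < n" using S(1) sub H1 by (auto simp: n_def P_def H1_def)
  have P: "m \<le> partial_w h y w" "partial_w h y w \<le> n" if "y \<in> {a..z}" "w \<in> Delta" for y w
    using s(2)[of "(y, w)"] S(2)[of "(y, w)"] that by (auto simp: P_def m_def n_def)
  obtain \<beta> e where \<beta>: "0 < \<beta>" "0 < e"
    "\<And>w. w \<in> Delta \<Longrightarrow> 1 - w < e \<Longrightarrow> \<beta> / 2 * (1 - w) ^ k \<le> p w \<and> p w \<le> 2 * \<beta> * (1 - w) ^ k"
    using H2_near_1[OF H2] by metis
  show thesis
  \<comment> \<open>With \<open>m\<close> and \<open>n\<close> the minimum and maximum of
    \<open>partial_w\<close>, the radius \<open>m * e\<close> ensures \<open>1 - w < e\<close>. The
    powers come from \<open>1 - w\<close>, the last division from the denominator of the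
    kernel.\<close>
  proof (rule that[of "\<beta> / 2 / n ^ k / n" "2 * \<beta> / m ^ k / m" "m * e"])
    fix x y assume y: "y \<in> {a..z}" and x: "h (y, -1) \<le> x" "x \<le> h (y, 1)" "h (y, 1) - x < m * e"
    define w where "w = fibre_inv h y x"
    have yX: "y \<in> X" using y sub by auto
    have w: "w \<in> Delta" "h (y, w) = x"
      unfolding w_def using fibre_inv_props[OF C1 H1 yX x(1,2)] by auto
    obtain t where t: "t \<in> Delta" "h (y, 1) - h (y, w) = partial_w h y t * (1 - w)"
      using mvt_w[OF C1 yX w(1), of 1] w(1) by auto
    define g where "g = h (y, 1) - x"
    have g: "g = partial_w h y t * (1 - w)" using t w by (simp add: g_def)
    have "m * (1 - w) \<le> g" "g \<le> n * (1 - w)"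
      unfolding g using P[OF y t(1)] w(1) by (auto intro!: mult_right_mono)
    then have gw: "g / n \<le> 1 - w" "1 - w \<le> g / m"
      using m n by (auto simp: pos_le_divide_eq pos_divide_le_eq ac_simps)
    have g0: "0 \<le> g" using x by (simp add: g_def)
    have "g / m < e" using x(3) m by (simp add: g_def pos_divide_less_eq ac_simps)
    then have p: "\<beta> / 2 * (1 - w) ^ k \<le> p w" "p w \<le> 2 * \<beta> * (1 - w) ^ k"
      using \<beta>(3)[OF w(1)] gw by auto
    have "\<beta> / 2 * (g / n) ^ k \<le> \<beta> / 2 * (1 - w) ^ k"
      using gw g0 n \<beta> by (intro mult_left_mono power_mono) auto
    then have p1: "\<beta> / 2 * (g / n) ^ k \<le> p w" using p by linarith
    have "2 * \<beta> * (1 - w) ^ k \<le> 2 * \<beta> * (g / m) ^ k"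
      using gw g0 n \<beta> w by (intro mult_left_mono power_mono) auto
    then have p2: "p w \<le> 2 * \<beta> * (g / m) ^ k" using p by linarith
    have "0 \<le> \<beta> / 2 * (g / n) ^ k" using \<beta> g0 n by simp
    then have "\<beta> / 2 * (g / n) ^ k / n \<le> p w / partial_w h y w"
      using p1 P[OF y w(1)] m n by (intro frac_le) auto
    moreover have "p w / partial_w h y w \<le> 2 * \<beta> * (g / m) ^ k / m"
      using p2 P[OF y w(1)] m \<beta> g0 by (intro frac_le) auto
    ultimately show "\<beta> / 2 / n ^ k / n * (h (y, 1) - x) ^ k \<le> p (fibre_inv h y x) / partial_w h y (fibre_inv h y x) \<and>
      p (fibre_inv h y x) / partial_w h y (fibre_inv h y x) \<le> 2 * \<beta> / m ^ k / m * (h (y, 1) - x) ^ k"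
      unfolding g_def[symmetric] w_def[symmetric] by (simp add: power_divide)
  qed (use m n \<beta> in auto)
qed


section \<open>The stationary measure and its density\<close>

lemma emeasure_stationary:
  assumes dens: "stationary_density X h p \<mu> \<phi>"
    and int: "is_interval X" "is_interval (measure_support \<mu>)"
    and A: "A \<in> sets borel" "A \<subseteq> X"
  shows "emeasure \<mu> A = (\<integral>\<^sup>+x\<in>A \<inter> measure_support \<mu>. ennreal (\<phi> x) \<partial>lborel)"
proof -
  define M where "M = measure_support \<mu>"
  have M: "M \<in> sets borel" and X: "X \<in> sets borel"
    using int real_interval_borel_measurable by (auto simp: M_def)
  have \<mu>: "\<mu> = density (restrict_space lborel X) (\<lambda>x. ennreal (\<phi> x) * indicator M x)"
    and "\<phi> \<in> borel_measurable (restrict_space borel M)"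
    using dens unfolding stationary_density_def Let_def M_def by auto
  then have "(\<lambda>x. ennreal (\<phi> x)) \<in> borel_measurable (restrict_space borel M)" by measurable
  then have meas: "(\<lambda>x. ennreal (\<phi> x) * indicator M x) \<in> borel_measurable borel"
    using M by (subst (asm) borel_measurable_restrict_space_iff_ennreal) auto
  have "emeasure \<mu> A = (\<integral>\<^sup>+x. ennreal (\<phi> x) * indicator M x * indicator A x \<partial>restrict_space lborel X)"
  proof (subst \<mu>, rule emeasure_density)
    show "(\<lambda>x. ennreal (\<phi> x) * indicator M x) \<in> borel_measurable (restrict_space lborel X)"
      by (rule measurable_restrict_space1) (use meas in simp)
    show "A \<in> sets (restrict_space lborel X)"
      using A X by (auto simp: sets_restrict_space_iff)
  qed
  also have "\<dots> = (\<integral>\<^sup>+x. ennreal (\<phi> x) * indicator M x * indicator A x * indicator X x \<partial>lborel)"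
    using X by (subst nn_integral_restrict_space) auto
  also have "\<dots> = (\<integral>\<^sup>+x\<in>A \<inter> M. ennreal (\<phi> x) \<partial>lborel)"
    using A(2) by (intro nn_integral_cong) (auto simp: indicator_def)
  finally show ?thesis by (simp add: M_def)
qed

text \<open>Otherwise the support lies in one point, a Lebesgue null set, and the absolutely
  continuous measure \<mu> would have total mass 0.\<close>

lemma support_point_less_Sup:
  assumes stat: "stationary_distribution X h \<nu> \<mu>" and dens: "stationary_density X h p \<mu> \<phi>"
    and int: "is_interval X" "is_interval (measure_support \<mu>)"
    and bdd: "bdd_above (measure_support \<mu>)"
  obtains a where "a \<in> measure_support \<mu>" "a < Sup (measure_support \<mu>)"
proof -
  define M where "M = measure_support \<mu>"
  have prob: "prob_space \<mu>" and sets: "sets \<mu> = sets (restrict_space borel X)"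
    using stat unfolding stationary_distribution_def borel_prob_on_def by auto
  have "space \<mu> = X" using sets_eq_imp_space_eq[OF sets] by (simp add: space_restrict_space)
  have "\<exists>a\<in>M. a < Sup M"
  proof (rule ccontr)
    assume "\<not> ?thesis"
    then have sub: "M \<subseteq> {Sup M}"
      using cSup_upper[of _ M] bdd by (force simp: M_def)
    have "emeasure \<mu> X = (\<integral>\<^sup>+x\<in>X \<inter> M. ennreal (\<phi> x) \<partial>lborel)"
      unfolding M_def using int real_interval_borel_measurable
      by (intro emeasure_stationary[OF dens]) auto
    also have "\<dots> = (\<integral>\<^sup>+x. 0 \<partial>(lborel :: real measure))"
    proof (rule nn_integral_cong_AE)
      show "AE x in lborel. ennreal (\<phi> x) * indicator (X \<inter> M) x = 0"
        using AE_lborel_singleton[of "Sup M"] by eventually_elim (use sub in \<open>auto simp: indicator_def\<close>)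
    qed
    finally have "emeasure \<mu> X = 0" by simp
    then show False using prob_space.emeasure_space_1[OF prob] \<open>space \<mu> = X\<close> by simp
  qed
  then show thesis using that unfolding M_def by blast
qed

section \<open>The fixed point equation in terms of the distance to the endpoint\<close>

lemma nn_integral_reflect:
  fixes f :: "real \<Rightarrow> ennreal"
  assumes "f \<in> borel_measurable borel"
  shows "(\<integral>\<^sup>+v. f v \<partial>lborel) = (\<integral>\<^sup>+y. f (c - y) \<partial>lborel)"
  using nn_integral_real_affine[OF assms, of "-1" c] by simp

text \<open>Reflection at \<open>xp\<close> turns the fixed point equation into the two integral
  inequalities, through the kernel bounds. Cutting off to \<open>(0, d]\<close> makes the reflected
  density measurable and nonnegative on the whole line, although \<phi> is controlled only on
  \<open>M\<close>.\<close>

lemma stationary_parabolic_kernel: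
  fixes X M :: "real set" and h :: "real \<times> real \<Rightarrow> real"
    and \<nu> \<mu> :: "real measure" and p \<phi> :: "real \<Rightarrow> real"
    and k q :: nat and \<alpha> xp :: real
  assumes rde: "random_difference_eq X h \<nu>"
    and H1: "H1 X h"
    and H2: "H2 \<nu> p k"
    and stat: "stationary_distribution X h \<nu> \<mu>"
    and M: "M = measure_support \<mu>" and int: "is_interval M"
    and dens: "stationary_density X h p \<mu> \<phi>"
    and q: "1 \<le> q"
    and bdd: "bdd_above M" and xp: "xp = Sup M"
    and fixp: "xp \<in> X" "h (xp, 1) = xp"
    and \<alpha>: "\<alpha> > 0"
    and expansion: "(\<lambda>x. h (x, 1) - (x + \<alpha> * (xp - x) ^ Suc q)) \<in> o[at xp within X](\<lambda>x. (xp - x) ^ Suc q)"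
  obtains b d c1 c2 where
    "parabolic_kernel (\<lambda>v. \<phi> (xp - v) * indicator {0<..d} v) (\<lambda>v. xp - h (xp - v, 1)) b d c1 c2 \<alpha> k q"
proof -
  have C1: "C1_on (X \<times> Delta) h" and intX: "is_interval X"
    using rde by (auto simp: random_difference_eq_def)
  have prob: "prob_space \<mu>" and sets: "sets \<mu> = sets (restrict_space borel X)"
    using stat unfolding stationary_distribution_def borel_prob_on_def by auto
  have space: "space \<mu> = X" using sets_eq_imp_space_eq[OF sets] by (simp add: space_restrict_space)
  have MX: "M \<subseteq> X" unfolding M measure_support_def space by auto
  have \<phi>_nonneg: "0 \<le> \<phi> x" if "x \<in> M" for x
    using dens that unfolding stationary_density_def Let_def M by auto
  have \<phi>_meas: "\<phi> \<in> borel_measurable (restrict_space borel M)"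
    using dens unfolding stationary_density_def Let_def M by auto
  have \<phi>_eq: "ennreal (\<phi> x) = (\<integral>\<^sup>+y\<in>{y \<in> M. h (y, -1) \<le> x \<and> x \<le> h (y, 1)}.
             ennreal (p (fibre_inv h y x) / partial_w h y (fibre_inv h y x) * \<phi> y) \<partial>lborel)"
    if "x \<in> M" for x
    using dens that unfolding stationary_density_def Let_def M by auto
  have M_le: "y \<le> xp" if "y \<in> M" for y
    unfolding xp using that bdd by (rule cSup_upper)
  obtain a where a: "a \<in> M" "a < xp"
    using support_point_less_Sup[OF stat dens intX] int bdd unfolding M xp by blast
  define d where "d = xp - a"
  have d: "0 < d" using a by (simp add: d_def)
  have subM: "{xp - d..<xp} \<subseteq> M"
  proof
    fix y assume y: "y \<in> {xp - d..<xp}"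
    then obtain m where "m \<in> M" "y < m" using less_cSup_iff[of M y] a bdd xp by auto
    then show "y \<in> M" using y a int mem_is_interval_1_I[of M a m y] by (auto simp: d_def)
  qed
  have subX: "{a..xp} \<subseteq> X"
    using a fixp MX intX by (meson atLeastAtMost_iff mem_is_interval_1_I subset_iff)
  note mono_x = H1_strict_mono_x[OF intX C1 H1]
  obtain c1 c2 e where c: "0 < c1" "0 < c2" "0 < e"
    and ker: "\<And>x y. y \<in> {a..xp} \<Longrightarrow> h (y, -1) \<le> x \<Longrightarrow> x \<le> h (y, 1) \<Longrightarrow> h (y, 1) - x < e \<Longrightarrow>
      c1 * (h (y, 1) - x) ^ k \<le> p (fibre_inv h y x) / partial_w h y (fibre_inv h y x) \<and>
      p (fibre_inv h y x) / partial_w h y (fibre_inv h y x) \<le> c2 * (h (y, 1) - x) ^ k"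
    using stationary_kernel_bounds[OF C1 H1 H2 subX] by metis
  \<comment> \<open>For \<open>u < b\<close>: \<open>d\<close> keeps \<open>xp - u\<close> in
    \<open>M\<close>; \<open>e\<close> makes the kernel bounds applicable, as
    \<open>h (y, 1) - (xp - u) \<le> u\<close>; \<open>xp - h (a, 1)\<close> excludes contributions
    from points below \<open>a\<close>; and \<open>xp - h (xp, -1)\<close> makes the condition
    \<open>h (y, -1) \<le> xp - u\<close> automatic for \<open>y\<close> in
    \<open>{a..xp}\<close>.\<close>
  define b where "b = Min {d, e, xp - h (a, 1), xp - h (xp, -1)}"
  have "h (a, 1) < xp" using mono_x[of 1 a xp] a fixp MX by auto
  moreover have "h (xp, -1) < xp" using H1_strict_mono_w[OF C1 H1 fixp(1), of "-1" 1] fixp by simp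
  ultimately have b: "0 < b" "b \<le> d" "b \<le> e" "b \<le> xp - h (a, 1)" "b \<le> xp - h (xp, -1)"
    using d c by (auto simp: b_def)
  define \<psi> where "\<psi> = (\<lambda>v. \<phi> (xp - v) * indicator {0<..d} v)"
  define H where "H = (\<lambda>v. xp - h (xp - v, 1))"
  have h_mono: "h (x, w) \<le> h (y, w)" if "x \<in> {a..xp}" "y \<in> {a..xp}" "x \<le> y" "w \<in> Delta" for x y w
  proof -
    have "x \<in> X" "y \<in> X" using that subX by blast+
    then show ?thesis using mono_x[OF that(4), of x y] that(3) by (cases "x = y") auto
  qed
  have \<psi>_meas[measurable]: "\<psi> \<in> borel_measurable borel"
  proof -
    have "\<phi> \<in> borel_measurable (restrict_space borel {xp - d..<xp})"
      using \<phi>_meas subM by (rule measurable_restrict_mono)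
    then have m: "(\<lambda>y. indicator {xp - d..<xp} y *\<^sub>R \<phi> y) \<in> borel_measurable borel"
      by (subst (asm) borel_measurable_restrict_space_iff) auto
    have "\<psi> = (\<lambda>v. (\<lambda>y. indicator {xp - d..<xp} y *\<^sub>R \<phi> y) (xp - v))"
      by (auto simp: \<psi>_def indicator_def)
    also have "\<dots> \<in> borel_measurable borel"
      by (rule measurable_compose[OF _ m]) measurable
    finally show ?thesis .
  qed
  have H_meas[measurable]: "(\<lambda>v. indicator {0<..d} v *\<^sub>R H v) \<in> borel_measurable borel"
  proof (rule borel_measurable_continuous_on_indicator)
    show "continuous_on {0<..d} H" unfolding H_def
      by (intro continuous_intros continuous_on_compose2[OF C1_on_imp_continuous_on[OF C1]])
        (use subX in \<open>auto simp: d_def\<close>)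
  qed simp
  have int_meas: "(\<lambda>v. ennreal (C * (u - H v) ^ k * \<psi> v) * indicator {v\<in>{0<..d}. H v \<le> u} v)
      \<in> borel_measurable borel" (is "?F \<in> _") for C u
  proof -
    define HI where "HI = (\<lambda>v. indicator {0<..d} v *\<^sub>R H v)"
    have [measurable]: "HI \<in> borel_measurable borel" unfolding HI_def by (rule H_meas)
    have "?F = (\<lambda>v. ennreal (C * (u - HI v) ^ k * \<psi> v) * indicator {v. HI v \<le> u} v * indicator {0<..d} v)"
      by (auto simp: HI_def indicator_def)
    also have "\<dots> \<in> borel_measurable borel" by measurable
    finally show ?thesis .
  qed
  \<comment> \<open>The point \<open>xp\<close> is left out because its reflection 0 is not in
    \<open>{0<..d}\<close>; being a null set, it does not affect the integrals.\<close>
  have domain: "y \<in> M \<and> h (y, -1) \<le> xp - u \<and> xp - u \<le> h (y, 1) \<longleftrightarrow>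
      xp - y \<in> {0<..d} \<and> H (xp - y) \<le> u" if u: "0 < u" "u < b" and y: "y \<noteq> xp" for u y
  proof
    assume L: "y \<in> M \<and> h (y, -1) \<le> xp - u \<and> xp - u \<le> h (y, 1)"
    have "a \<le> y"
    proof (rule ccontr)
      assume "\<not> a \<le> y"
      then have "h (y, 1) < h (a, 1)" using L a MX by (intro mono_x) auto
      then show False using L u b by auto
    qed
    then show "xp - y \<in> {0<..d} \<and> H (xp - y) \<le> u"
      using L y M_le[of y] by (auto simp: d_def H_def)
  next
    assume R: "xp - y \<in> {0<..d} \<and> H (xp - y) \<le> u"
    then have "y \<in> {xp - d..<xp}" by auto
    then have "y \<in> M" "y \<in> {a..xp}" using subM by (auto simp: d_def)
    moreover have "h (y, -1) \<le> h (xp, -1)"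
      using calculation a by (intro h_mono) auto
    ultimately show "y \<in> M \<and> h (y, -1) \<le> xp - u \<and> xp - u \<le> h (y, 1)"
      using R u b by (auto simp: H_def)
  qed
  have eq: "ennreal (\<psi> u) = (\<integral>\<^sup>+y\<in>{y \<in> M. h (y, -1) \<le> xp - u \<and> xp - u \<le> h (y, 1)}.
      ennreal (p (fibre_inv h y (xp - u)) / partial_w h y (fibre_inv h y (xp - u)) * \<phi> y) \<partial>lborel)"
    if u: "0 < u" "u < b" for u
  proof -
    have "xp - u \<in> M" using subM u b by (auto simp: subset_iff)
    then show ?thesis using u b by (subst \<phi>_eq[symmetric]) (auto simp: \<psi>_def)
  qed
  have kernel: "c1 * (u - H (xp - y)) ^ k * \<psi> (xp - y)
        \<le> p (fibre_inv h y (xp - u)) / partial_w h y (fibre_inv h y (xp - u)) * \<phi> y"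
      "p (fibre_inv h y (xp - u)) / partial_w h y (fibre_inv h y (xp - u)) * \<phi> y
        \<le> c2 * (u - H (xp - y)) ^ k * \<psi> (xp - y)"
    if u: "0 < u" "u < b" and y: "y \<noteq> xp" "xp - y \<in> {0<..d}" "H (xp - y) \<le> u" for u y
  proof -
    have D: "y \<in> M" "h (y, -1) \<le> xp - u" "xp - u \<le> h (y, 1)"
      using domain[OF u y(1)] y by auto
    have ya: "y \<in> {a..xp}" using y by (auto simp: d_def)
    have "h (y, 1) \<le> h (xp, 1)" using ya a by (intro h_mono) auto
    then have "h (y, 1) - (xp - u) < e" using fixp u b by simp
    note K = ker[OF ya D(2,3) this]
    have 1: "u - H (xp - y) = h (y, 1) - (xp - u)" by (simp add: H_def)
    have 2: "\<psi> (xp - y) = \<phi> y" using y by (simp add: \<psi>_def)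
    show "c1 * (u - H (xp - y)) ^ k * \<psi> (xp - y)
        \<le> p (fibre_inv h y (xp - u)) / partial_w h y (fibre_inv h y (xp - u)) * \<phi> y"
      unfolding 1 2 using K \<phi>_nonneg[OF D(1)] by (intro mult_right_mono) auto
    show "p (fibre_inv h y (xp - u)) / partial_w h y (fibre_inv h y (xp - u)) * \<phi> y
        \<le> c2 * (u - H (xp - y)) ^ k * \<psi> (xp - y)"
      unfolding 1 2 using K \<phi>_nonneg[OF D(1)] by (intro mult_right_mono) auto
  qed
  have mass: "(\<integral>\<^sup>+v\<in>{0<..t}. ennreal (\<psi> v) \<partial>lborel) = emeasure \<mu> {xp - t..<xp}" if t: "0 < t" "t \<le> d" for t
  proof -
    have "(\<integral>\<^sup>+v\<in>{0<..t}. ennreal (\<psi> v) \<partial>lborel) = 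
        (\<integral>\<^sup>+y. ennreal (\<psi> (xp - y)) * indicator {0<..t} (xp - y) \<partial>lborel)"
      by (rule nn_integral_reflect) measurable
    also have "\<dots> = (\<integral>\<^sup>+y\<in>{xp - t..<xp} \<inter> M. ennreal (\<phi> y) \<partial>lborel)"
      using t subM by (intro nn_integral_cong) (auto simp: \<psi>_def indicator_def subset_iff)
    also have "\<dots> = emeasure \<mu> {xp - t..<xp}"
      unfolding M using subM MX t int
      by (intro emeasure_stationary[OF dens intX, symmetric]) (auto simp: M subset_iff)
    finally show ?thesis .
  qed
  have "parabolic_kernel \<psi> H b d c1 c2 \<alpha> k q"
  proof
    show "H 0 = 0" using fixp by (simp add: H_def)
    show "H v \<le> H w" if "0 \<le> v" "v \<le> w" "w \<le> d" for v w
      unfolding H_def using that h_mono[of "xp - w" "xp - v" 1] by (auto simp: d_def)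
    show "((\<lambda>v. (v - H v) / v ^ Suc q) \<longlongrightarrow> \<alpha>) (at_right 0)"
    proof -
      have "\<forall>\<^sub>F v in at_right 0. 0 < v \<and> v < d"
        unfolding eventually_at_right_field using d by (intro exI[of _ d]) auto
      then have ev: "\<forall>\<^sub>F v in at_right 0. xp - v \<in> X \<and> xp - v \<noteq> xp \<and> 0 < v"
        by eventually_elim (use subX in \<open>auto simp: d_def subset_iff\<close>)
      have "((\<lambda>v. xp - v) \<longlongrightarrow> xp - 0) (at_right 0)" by (intro tendsto_intros)
      then have fl: "filterlim (\<lambda>v. xp - v) (at xp within X) (at_right 0)"
        unfolding filterlim_at using ev by (auto elim: eventually_mono)
      have "(\<lambda>v. h (xp - v, 1) - (xp - v + \<alpha> * (xp - (xp - v)) ^ Suc q)) \<in> o[at_right 0](\<lambda>v. (xp - (xp - v)) ^ Suc q)"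
        using landau_o.small.compose[OF expansion fl] by simp
      then have "((\<lambda>v. (v - H v - \<alpha> * v ^ Suc q) / v ^ Suc q) \<longlongrightarrow> 0) (at_right 0)"
        by (intro smalloD_tendsto) (simp add: H_def algebra_simps)
      then have "((\<lambda>v. (v - H v - \<alpha> * v ^ Suc q) / v ^ Suc q + \<alpha>) \<longlongrightarrow> 0 + \<alpha>) (at_right 0)"
        by (intro tendsto_intros)
      then have "((\<lambda>v. (v - H v - \<alpha> * v ^ Suc q) / v ^ Suc q + \<alpha>) \<longlongrightarrow> \<alpha>) (at_right 0)" by simp
      then show ?thesis
        by (rule Lim_transform_eventually)
          (use ev in eventually_elim, simp add: diff_divide_distrib del: power_Suc)
    qed
    show "0 \<le> \<psi> v" for v
      unfolding \<psi>_def using subM \<phi>_nonneg[of "xp - v"] by (auto simp: indicator_def subset_iff)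
    show "ennreal (\<psi> u) \<le> (\<integral>\<^sup>+v\<in>{v\<in>{0<..d}. H v \<le> u}. ennreal (c2 * (u - H v) ^ k * \<psi> v) \<partial>lborel)"
      if u: "0 < u" "u < b" for u
      unfolding eq[OF u] nn_integral_reflect[OF int_meas, of _ _ xp]
    proof (rule nn_integral_mono_AE)
      show "AE y in lborel. ennreal (p (fibre_inv h y (xp - u)) / partial_w h y (fibre_inv h y (xp - u)) * \<phi> y) *
          indicator {y \<in> M. h (y, -1) \<le> xp - u \<and> xp - u \<le> h (y, 1)} y
          \<le> ennreal (c2 * (u - H (xp - y)) ^ k * \<psi> (xp - y)) * indicator {v\<in>{0<..d}. H v \<le> u} (xp - y)"
        using AE_lborel_singleton[of xp]
      proof eventually_elim
        case (elim y)
        then show ?case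
          using domain[OF u elim] kernel(2)[OF u elim] unfolding indicator_def mem_Collect_eq
          by (auto intro!: ennreal_leI simp del: times_divide_eq_left)
      qed
    qed
    show "(\<integral>\<^sup>+v\<in>{v\<in>{0<..d}. H v \<le> u}. ennreal (c1 * (u - H v) ^ k * \<psi> v) \<partial>lborel) \<le> ennreal (\<psi> u)"
      if u: "0 < u" "u < b" for u
      unfolding eq[OF u] nn_integral_reflect[OF int_meas, of _ _ xp]
    proof (rule nn_integral_mono_AE)
      show "AE y in lborel. ennreal (c1 * (u - H (xp - y)) ^ k * \<psi> (xp - y)) * indicator {v\<in>{0<..d}. H v \<le> u} (xp - y)
          \<le> ennreal (p (fibre_inv h y (xp - u)) / partial_w h y (fibre_inv h y (xp - u)) * \<phi> y) *
          indicator {y \<in> M. h (y, -1) \<le> xp - u \<and> xp - u \<le> h (y, 1)} y"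
        using AE_lborel_singleton[of xp]
      proof eventually_elim
        case (elim y)
        then show ?case
          using domain[OF u elim] kernel(1)[OF u elim] unfolding indicator_def mem_Collect_eq
          by (auto intro!: ennreal_leI simp del: times_divide_eq_left)
      qed
    qed
    show "0 < (\<integral>\<^sup>+v\<in>{0<..t}. ennreal (\<psi> v) \<partial>lborel)" if t: "0 < t" "t \<le> d" for t
    proof -
      \<comment> \<open>The midpoint \<open>xp - t / 2\<close> is in the support, so its open
        neighbourhood \<open>U\<close> has positive measure.\<close>
      define U where "U = {xp - t<..<xp}"
      have "xp - t / 2 \<in> M" using subM t by (auto simp: subset_iff)
      then have "0 < emeasure \<mu> (U \<inter> space \<mu>)"
        using t unfolding M measure_support_def by (auto simp: U_def)
      also have "\<dots> \<le> emeasure \<mu> {xp - t..<xp}"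
      proof (rule emeasure_mono)
        show "U \<inter> space \<mu> \<subseteq> {xp - t..<xp}" by (auto simp: U_def)
        have "{xp - t..<xp} \<subseteq> X" using subM MX t by (auto simp: subset_iff)
        then show "{xp - t..<xp} \<in> sets \<mu>"
          unfolding sets using intX real_interval_borel_measurable by (auto simp: sets_restrict_space_iff)
      qed
      finally show ?thesis using mass[OF t] by simp
    qed
    show "(\<integral>\<^sup>+v\<in>{0<..d}. ennreal (\<psi> v) \<partial>lborel) < \<infinity>"
      using mass[of d] d prob_space.emeasure_le_1[OF prob, of "{xp - d..<xp}"]
      by (simp add: le_less_trans)
  qed (use q \<alpha> b c \<psi>_meas in auto)
  then show thesis using that unfolding \<psi>_def H_def by blast
qed

section \<open>Return to the original coordinate\<close>

theorem theorem2:
  fixes X M :: "real set" and h :: "real \<times> real \<Rightarrow> real"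
    and \<nu> \<mu> :: "real measure" and p \<phi> :: "real \<Rightarrow> real"
    and k r :: nat and \<alpha> xp :: real
  assumes "random_difference_eq X h \<nu>"
    and "H1 X h"
    and "H2 \<nu> p k"
    and "stationary_distribution X h \<nu> \<mu>"
    and "M = measure_support \<mu>" and "is_interval M"
    and "stationary_density X h p \<mu> \<phi>"
    and "r \<ge> 2"
    and "local_diffeomorphism (r + 1) X (\<lambda>x. h (x, 1))"
    and "bdd_above M" and "xp = Sup M"
    and "nonhyperbolic_fixed_point X (\<lambda>x. h (x, 1)) xp"
    and "\<alpha> > 0"
    and "(\<lambda>x. h (x, 1) - (x + \<alpha> * (xp - x) ^ r)) \<in> o[at xp within X](\<lambda>x. (xp - x) ^ r)"
  shows "((\<lambda>x. (xp - x) ^ (r - 1) * ln (\<phi> x) / ln (xp - x))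
           \<longlongrightarrow> real r * (real k + 1) / (\<alpha> * (real r - 1))) (at xp within (M \<inter> {..<xp}))"
proof -
  obtain q where r: "r = Suc q" and q: "1 \<le> q"
    using assms(8) by (cases r) auto
  have fixp: "xp \<in> X" "h (xp, 1) = xp"
    using assms(12) by (auto simp: nonhyperbolic_fixed_point_def)
  obtain b d c1 c2 where
    pk: "parabolic_kernel (\<lambda>v. \<phi> (xp - v) * indicator {0<..d} v) (\<lambda>v. xp - h (xp - v, 1)) b d c1 c2 \<alpha> k q"
    using stationary_parabolic_kernel[OF assms(1-7) q assms(10,11) fixp assms(13) assms(14)[unfolded r]] by metis
  have d: "0 < d" using pk unfolding parabolic_kernel_def by linarith
  have fl: "filterlim (\<lambda>x. xp - x) (at_right 0) (at xp within (M \<inter> {..<xp}))"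
    unfolding filterlim_at
  proof
    show "\<forall>\<^sub>F x in at xp within (M \<inter> {..<xp}). xp - x \<in> {0<..} \<and> xp - x \<noteq> 0"
      by (auto simp: eventually_at_filter)
    have "((\<lambda>x. xp - x) \<longlongrightarrow> xp - xp) (at xp within (M \<inter> {..<xp}))" by (intro tendsto_intros)
    then show "((\<lambda>x. xp - x) \<longlongrightarrow> 0) (at xp within (M \<inter> {..<xp}))" by simp
  qed
  \<comment> \<open>The limit concerns only small \<open>u\<close>, where the cutoff factor is
    1.\<close>
  have "\<forall>\<^sub>F u in at_right 0. 0 < u \<and> u < d"
    unfolding eventually_at_right_field using d by (intro exI[of _ d]) auto
  then have ev: "\<forall>\<^sub>F u in at_right 0.
      u ^ q * ln (\<phi> (xp - u) * indicator {0<..d} u) / ln u = u ^ q * ln (\<phi> (xp - u)) / ln u"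
    by eventually_elim simp
  have "((\<lambda>u. u ^ q * ln (\<phi> (xp - u)) / ln u) \<longlongrightarrow> Suc q * (k + 1) / (\<alpha> * q)) (at_right 0)"
    using parabolic_kernel.ln_psi_asymptotics[OF pk] ev by (rule Lim_transform_eventually)
  moreover have "real (Suc q * (k + 1)) / (\<alpha> * q) = real r * (real k + 1) / (\<alpha> * (real r - 1))"
    by (simp add: r algebra_simps)
  ultimately have "((\<lambda>u. u ^ q * ln (\<phi> (xp - u)) / ln u) \<longlongrightarrow>
      real r * (real k + 1) / (\<alpha> * (real r - 1))) (at_right 0)"
    by simp
  from filterlim_compose[OF this fl] show ?thesis by (simp add: r)
qed

end
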